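(* Let $\Xi\colon\mathbb{P}_{\mathbb{C}}^{1|1}\times B\to\mathbb{P}_{\mathbb{C}}^{1|1}\times B$ be a superconformal automorphism over $B$ such that $$[0:1:0]\mapsto[0:1:0],\qquad[1:1:\epsilon]\mapsto[1:1:\epsilon'],\qquad[1:0:0]\mapsto[1:0:0]$$ for some odd $\epsilon,\epsilon'\in(\mathcal{O}_B\otimes\mathbb{C})_1$. Then $\epsilon=\pm\epsilon'$. If $\epsilon=\epsilon'=0$, the automorphism $\Xi$ is either the identity or $\Xi_-$. If $\epsilon\ne0$ and $\epsilon=\epsilon'$, the automorphism $\Xi$ is the identity. If $\epsilon\neq0$ and $\epsilon=-\epsilon'$, the automorphism $\Xi$ is $\Xi_-$.
   Context: $B=\mathbb{R}^{0|s}$ is a superpoint with ring of functions $\mathcal{O}_B$ (a real Grassmann algebra). $\mathbb{P}_{\mathbb{C}}^{1|1}$ is covered by two copies of $\mathbb{C}^{1|1}$ with holomorphic coordinates $(z_1,\theta_1)$, $(z_2,\theta_2)$, $z_2=1/z_1$, $\theta_2=\theta_1/z_1$. Its super Riemann surface structure is the distribution $\mathcal{D}\subset T\mathbb{P}_{\mathbb{C}}^{1|1}$ generated by $\partial_{\theta_1}+\theta_1\partial_{z_1}$ and $\partial_{\theta_2}-\theta_2\partial_{z_2}$ in the respective charts. A superconformal automorphism over $B$ is a holomorphic automorphism of $\mathbb{P}_{\mathbb{C}}^{1|1}\times B$ over $B$ preserving $\mathcal{D}$. A $B$-point of $\mathbb{P}_{\mathbb{C}}^{1|1}$ (map $B\to\mathbb{P}_{\mathbb{C}}^{1|1}$)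 is written in projective coordinates $[Z_1:Z_2:\Theta]$ with $Z_1,Z_2\in(\mathcal{O}_B\otimes\mathbb{C})_0$, at least one of them invertible, $\Theta\in(\mathcal{O}_B\otimes\mathbb{C})_1$, up to multiplication by an invertible even element; it is the point $z_1=Z_1/Z_2$, $\theta_1=\Theta/Z_2$ if $Z_2$ is invertible, and $z_2=Z_2/Z_1$, $\theta_2=\Theta/Z_1$ if $Z_1$ is invertible. $\Xi_-$ is the reflection of the odd direction, given by $\Xi_-^\#z_1=z_1$, $\Xi_-^\#\theta_1=-\theta_1$. *)

theory Defs
  imports "HOL-Complex_Analysis.Complex_Analysis"
begin

section \<open>Complex Grassmann algebras\<close>

text \<open>
  One ambient type carries all Grassmann algebras that occur.  Its elements are formal
  combinations of the monomials \<open>e\<^sub>S\<close>, for finite \<open>S\<close>, where \<open>e\<^sub>S\<close> is the product of the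
  generators \<open>e\<^sub>k\<close> with \<open>k \<in> S\<close> in increasing order.  The generator \<open>e\<^sub>0\<close> plays the role of the odd
  coordinate \<open>\<theta>\<close> of a chart; \<open>e\<^sub>1, \<dots>, e\<^sub>s\<close> are the odd coordinates of \<open>B\<close>.
\<close>

typedef grassmann = "{f :: nat set \<Rightarrow> complex. \<forall>S. infinite S \<longrightarrow> f S = 0}"
  morphisms gcoeff Abs_grassmann
  by (rule exI[of _ "\<lambda>_. 0"]) simp

setup_lifting type_definition_grassmann

lemma grassmann_eqI: "(\<And>S. finite S \<Longrightarrow> gcoeff x S = gcoeff y S) \<Longrightarrow> x = y"
  by transfer (metis ext)

text \<open>The sign in \<open>e\<^sub>A * e\<^sub>B = koszul_sign A B * e\<^sub>A\<^sub>\<union>\<^sub>B\<close> for disjoint \<open>A\<close> and \<open>B\<close>.\<close>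

definition koszul_sign :: "nat set \<Rightarrow> nat set \<Rightarrow> complex" where
  "koszul_sign A B = (-1) ^ card {(a, b). a \<in> A \<and> b \<in> B \<and> b < a}"

lemma koszul_sign_empty [simp]: "koszul_sign {} B = 1" "koszul_sign A {} = 1"
  by (simp_all add: koszul_sign_def)

lemma koszul_sign_finite: "finite A \<Longrightarrow> finite B \<Longrightarrow> finite {(a, b). a \<in> A \<and> b \<in> B \<and> b < (a::nat)}"
  by (rule finite_subset[of _ "A \<times> B"]) auto

lemma koszul_sign_Un_left:
  assumes "finite A" "finite B" "finite C" "A \<inter> B = {}"
  shows "koszul_sign (A \<union> B) C = koszul_sign A C * koszul_sign B C"
proof -
  have "{(a, c). a \<in> A \<union> B \<and> c \<in> C \<and> c < a} =
      {(a, c). a \<in> A \<and> c \<in> C \<and> c < a} \<union> {(a, c). a \<in> B \<and> c \<in> C \<and> c < a}"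
    by auto
  moreover have "{(a, c). a \<in> A \<and> c \<in> C \<and> c < a} \<inter> {(a, c). a \<in> B \<and> c \<in> C \<and> c < a} = {}"
    using assms(4) by auto
  ultimately show ?thesis
    using assms by (simp add: koszul_sign_def card_Un_disjoint koszul_sign_finite power_add)
qed

lemma koszul_sign_Un_right:
  assumes "finite A" "finite B" "finite C" "B \<inter> C = {}"
  shows "koszul_sign A (B \<union> C) = koszul_sign A B * koszul_sign A C"
proof -
  have "{(a, c). a \<in> A \<and> c \<in> B \<union> C \<and> c < a} =
      {(a, c). a \<in> A \<and> c \<in> B \<and> c < a} \<union> {(a, c). a \<in> A \<and> c \<in> C \<and> c < a}"
    by auto
  moreover have "{(a, c). a \<in> A \<and> c \<in> B \<and> c < a} \<inter> {(a, c). a \<in> A \<and> c \<in> C \<and> c < a} = {}"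
    using assms(4) by auto
  ultimately show ?thesis
    using assms by (simp add: koszul_sign_def card_Un_disjoint koszul_sign_finite power_add)
qed

instantiation grassmann :: ring_1
begin

lift_definition zero_grassmann :: grassmann is "\<lambda>_. 0" by simp
lift_definition one_grassmann :: grassmann is "\<lambda>S. if S = {} then 1 else 0" by auto
lift_definition plus_grassmann :: "grassmann \<Rightarrow> grassmann \<Rightarrow> grassmann" is "\<lambda>f g S. f S + g S" by simp
lift_definition minus_grassmann :: "grassmann \<Rightarrow> grassmann \<Rightarrow> grassmann" is "\<lambda>f g S. f S - g S" by simp
lift_definition uminus_grassmann :: "grassmann \<Rightarrow> grassmann" is "\<lambda>f S. - f S" by simp
lift_definition times_grassmann :: "grassmann \<Rightarrow> grassmann \<Rightarrow> grassmann"
  is "\<lambda>f g S. \<Sum>A\<in>Pow S. koszul_sign A (S - A) * f A * g (S - A)"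
  by (simp add: finite_Pow_iff)

instance
proof
  fix a b c :: grassmann
  show "a * b * c = a * (b * c)"
  proof (rule grassmann_eqI)
    fix S :: "nat set"
    assume fin: "finite S"
    define t where "t = (\<lambda>A B. koszul_sign A (S - A) * koszul_sign B (S - A - B) *
      gcoeff a A * gcoeff b B * gcoeff c (S - A - B))"
    have "gcoeff (a * b * c) S = (\<Sum>C\<in>Pow S. \<Sum>A\<in>Pow C. koszul_sign C (S - C) *
        (koszul_sign A (C - A) * gcoeff a A * gcoeff b (C - A)) * gcoeff c (S - C))"
      by (simp add: times_grassmann.rep_eq sum_distrib_left sum_distrib_right)
    also have "\<dots> = (\<Sum>(C, A)\<in>Sigma (Pow S) Pow. koszul_sign C (S - C) *
        (koszul_sign A (C - A) * gcoeff a A * gcoeff b (C - A)) * gcoeff c (S - C))"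
      using fin by (subst sum.Sigma) (auto intro: finite_subset)
    also have "\<dots> = (\<Sum>(A, B)\<in>Sigma (Pow S) (\<lambda>A. Pow (S - A)). t A B)"
    proof (rule sum.reindex_bij_witness[of _ "\<lambda>(A, B). (A \<union> B, A)" "\<lambda>(C, A). (A, C - A)"], goal_cases)
      case (5 p)
      then obtain C A where p: "p = (C, A)" and CS: "C \<subseteq> S" and AC: "A \<subseteq> C" by auto
      have f: "finite C" "finite A" "finite (C - A)" "finite (S - C)"
        using fin CS AC by (auto intro: finite_subset)
      have 1: "koszul_sign C (S - C) = koszul_sign A (S - C) * koszul_sign (C - A) (S - C)"
        using koszul_sign_Un_left[of A "C - A" "S - C"] f AC by (simp add: Un_absorb1)
      have "(C - A) \<union> (S - C) = S - A" using CS AC by auto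
      then have 2: "koszul_sign A (S - A) = koszul_sign A (C - A) * koszul_sign A (S - C)"
        using koszul_sign_Un_right[of A "C - A" "S - C"] f by (metis Diff_disjoint Int_Diff Int_commute Int_empty_left)
      have "S - A - (C - A) = S - C" using CS AC by auto
      then show ?case by (simp add: p t_def 1 2 algebra_simps)
    qed auto
    also have "\<dots> = (\<Sum>A\<in>Pow S. \<Sum>B\<in>Pow (S - A). t A B)"
      using fin by (subst sum.Sigma) (auto intro: finite_subset)
    also have "\<dots> = gcoeff (a * (b * c)) S"
      by (simp add: times_grassmann.rep_eq t_def sum_distrib_left algebra_simps)
    finally show "gcoeff (a * b * c) S = gcoeff (a * (b * c)) S" .
  qed
  show "1 * a = a"
  proof (rule grassmann_eqI)
    fix S :: "nat set"
    assume "finite S"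
    then have "(\<Sum>A\<in>Pow S. koszul_sign A (S - A) * (if A = {} then 1 else 0) * gcoeff a (S - A)) =
      (\<Sum>A\<in>{{}}. gcoeff a (S - A))"
      by (intro sum.mono_neutral_cong_right) auto
    then show "gcoeff (1 * a) S = gcoeff a S"
      by (simp add: times_grassmann.rep_eq one_grassmann.rep_eq)
  qed
  show "a * 1 = a"
  proof (rule grassmann_eqI)
    fix S :: "nat set"
    assume "finite S"
    then have "(\<Sum>A\<in>Pow S. koszul_sign A (S - A) * gcoeff a A * (if S - A = {} then 1 else 0)) =
      (\<Sum>A\<in>{S}. gcoeff a A)"
      by (intro sum.mono_neutral_cong_right) auto
    then show "gcoeff (a * 1) S = gcoeff a S"
      by (simp add: times_grassmann.rep_eq one_grassmann.rep_eq)
  qed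
  show "(a + b) * c = a * c + b * c" "a * (b + c) = a * b + a * c"
    by (transfer, simp add: algebra_simps sum.distrib)+
  show "(0::grassmann) \<noteq> 1"
    by transfer (metis one_neq_zero)
qed (transfer; simp add: algebra_simps)+

end

lift_definition const_grassmann :: "complex \<Rightarrow> grassmann" is "\<lambda>c S. if S = {} then c else 0" by auto

lift_definition theta :: grassmann is "\<lambda>S. if S = {0} then 1 else 0" by auto

text \<open>The substitution \<open>\<theta> \<mapsto> c \<theta>\<close>, and the left derivative \<open>\<partial>\<^sub>\<theta>\<close>; since \<open>e\<^sub>0\<close> comes first in every
  monomial, no sign appears in the latter.\<close>

lift_definition scale_theta :: "complex \<Rightarrow> grassmann \<Rightarrow> grassmann"
  is "\<lambda>c f S. if 0 \<in> S then c * f S else f S" by simp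

lift_definition d_theta :: "grassmann \<Rightarrow> grassmann"
  is "\<lambda>f S. if 0 \<in> S then 0 else f (insert 0 S)" by simp

text \<open>
  \<open>supported G\<close> is the subalgebra generated by the \<open>e\<^sub>k\<close> with \<open>k \<in> G\<close>.
  \<open>Lam s\<close> is \<open>O\<^sub>B \<otimes> \<complex>\<close> for \<open>B = \<real>\<^sup>0\<^sup>|\<^sup>s\<close>: the complexification of the real Grassmann algebra on \<open>s\<close>
  generators is the complex Grassmann algebra on \<open>s\<close> generators.
\<close>

definition supported :: "nat set \<Rightarrow> grassmann set" where
  "supported G = {x. \<forall>S. gcoeff x S \<noteq> 0 \<longrightarrow> S \<subseteq> G}"

definition even_grassmann :: "grassmann \<Rightarrow> bool" where
  "even_grassmann x \<longleftrightarrow> (\<forall>S. gcoeff x S \<noteq> 0 \<longrightarrow> even (card S))"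

definition odd_grassmann :: "grassmann \<Rightarrow> bool" where
  "odd_grassmann x \<longleftrightarrow> (\<forall>S. gcoeff x S \<noteq> 0 \<longrightarrow> odd (card S))"

definition Lam :: "nat \<Rightarrow> grassmann set" where
  "Lam s = supported {1..s}"

definition Lam_even :: "nat \<Rightarrow> grassmann set" where
  "Lam_even s = {x \<in> Lam s. even_grassmann x}"

definition Lam_odd :: "nat \<Rightarrow> grassmann set" where
  "Lam_odd s = {x \<in> Lam s. odd_grassmann x}"

definition Lam_invertible :: "nat \<Rightarrow> grassmann \<Rightarrow> bool" where
  "Lam_invertible s x \<longleftrightarrow> x \<in> Lam s \<and> (\<exists>y\<in>Lam s. x * y = 1 \<and> y * x = 1)"


section \<open>The underlying projective line\<close>

datatype proj_line = Aff complex | Infty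

text \<open>\<open>chart i\<close> is the inverse of the coordinate \<open>z\<^sub>i\<close>, where \<open>z\<^sub>2 = 1 / z\<^sub>1\<close>.\<close>

datatype chart_index = C1 | C2

fun chart :: "chart_index \<Rightarrow> complex \<Rightarrow> proj_line" where
  "chart C1 z = Aff z"
| "chart C2 z = (if z = 0 then Infty else Aff (1 / z))"

definition coord_patch :: "chart_index \<Rightarrow> proj_line set" where
  "coord_patch i = range (chart i)"

instantiation proj_line :: topological_space
begin

definition open_proj_line :: "proj_line set \<Rightarrow> bool" where
  "open_proj_line U \<longleftrightarrow> (\<forall>i. open (chart i -` U))"

instance
proof
  fix S T :: "proj_line set" and K :: "proj_line set set"
  show "open (UNIV :: proj_line set)" by (simp add: open_proj_line_def)
  show "open S \<Longrightarrow> open T \<Longrightarrow> open (S \<inter> T)" by (auto simp: open_proj_line_def)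
  show "\<forall>S\<in>K. open S \<Longrightarrow> open (\<Union>K)" by (auto simp: open_proj_line_def vimage_Union)
qed

end


section \<open>The structure sheaf\<close>

text \<open>
  A superfunction on an open part \<open>V\<close> of a chart, \<open>f\<^sub>0(z) + \<theta> f\<^sub>1(z)\<close> with \<open>f\<^sub>0, f\<^sub>1 : V \<rightarrow> Lam s\<close>, is
  a map from \<open>V\<close> to the Grassmann algebra generated by \<open>\<theta>\<close> and \<open>Lam s\<close>; it is holomorphic if its
  coefficients are.  A section over \<open>U\<close> is a pair of such superfunctions, one for each chart, that
  agree under \<open>z\<^sub>2 = 1 / z\<^sub>1\<close>, \<open>\<theta>\<^sub>2 = \<theta>\<^sub>1 / z\<^sub>1\<close>.  Outside \<open>U\<close> the representatives are set to \<open>0\<close>,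
  so that equality of sections is equality in HOL.
\<close>

type_synonym ssection = "chart_index \<Rightarrow> complex \<Rightarrow> grassmann"

definition sections :: "nat \<Rightarrow> proj_line set \<Rightarrow> ssection set" where
  "sections s U = {f.
     (\<forall>i z. f i z \<in> supported {0..s}) \<and>
     (\<forall>i S. (\<lambda>z. gcoeff (f i z) S) holomorphic_on (chart i -` U)) \<and>
     (\<forall>i z. chart i z \<notin> U \<longrightarrow> f i z = 0) \<and>
     (\<forall>z. z \<noteq> 0 \<longrightarrow> f C1 z = scale_theta (1 / z) (f C2 (1 / z)))}"

definition even_section :: "ssection \<Rightarrow> bool" where
  "even_section f \<longleftrightarrow> (\<forall>i z. even_grassmann (f i z))"

definition odd_section :: "ssection \<Rightarrow> bool" where
  "odd_section f \<longleftrightarrow> (\<forall>i z. odd_grassmann (f i z))"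

definition sec_add :: "ssection \<Rightarrow> ssection \<Rightarrow> ssection" where
  "sec_add f g = (\<lambda>i z. f i z + g i z)"

definition sec_mult :: "ssection \<Rightarrow> ssection \<Rightarrow> ssection" where
  "sec_mult f g = (\<lambda>i z. f i z * g i z)"

definition sec_const :: "proj_line set \<Rightarrow> grassmann \<Rightarrow> ssection" where
  "sec_const U a = (\<lambda>i z. if chart i z \<in> U then a else 0)"

definition sec_res :: "proj_line set \<Rightarrow> ssection \<Rightarrow> ssection" where
  "sec_res V f = (\<lambda>i z. if chart i z \<in> V then f i z else 0)"

text \<open>The value at a point of the underlying complex function; \<open>f\<close> is in the maximal ideal of the
  stalk at \<open>p\<close> iff it vanishes.\<close>

fun body_at :: "ssection \<Rightarrow> proj_line \<Rightarrow> complex" where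
  "body_at f (Aff z) = gcoeff (f C1 z) {}"
| "body_at f Infty = gcoeff (f C2 0) {}"

text \<open>The coordinates \<open>z\<^sub>i\<close>, \<open>\<theta>\<^sub>i\<close> as sections over \<open>coord_patch i\<close>.\<close>

definition z_section :: "chart_index \<Rightarrow> ssection" where
  "z_section i = (\<lambda>j z. if j = i then const_grassmann z
     else if z = 0 then 0 else const_grassmann (1 / z))"

definition theta_section :: "chart_index \<Rightarrow> ssection" where
  "theta_section i = (\<lambda>j z. if j = i then theta
     else if z = 0 then 0 else const_grassmann (1 / z) * theta)"


section \<open>Morphisms over the base\<close>

text \<open>Endomorphisms of the locally ringed superspace \<open>\<P>\<^sup>1\<^sup>|\<^sup>1 \<times> B\<close> over \<open>B\<close>: a continuous map and
  a local homomorphism of sheaves of superalgebras that fixes \<open>O\<^sub>B \<otimes> \<complex>\<close>.\<close>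

record supermap =
  on_points :: "proj_line \<Rightarrow> proj_line"
  pullback :: "proj_line set \<Rightarrow> ssection \<Rightarrow> ssection"

definition morphism :: "nat \<Rightarrow> supermap \<Rightarrow> bool" where
  "morphism s \<Xi> \<longleftrightarrow>
     continuous_on UNIV (on_points \<Xi>) \<and>
     pullback \<Xi> \<in> (\<Pi>\<^sub>E U\<in>{U. open U}. sections s U \<rightarrow>\<^sub>E sections s (on_points \<Xi> -` U)) \<and>
     (\<forall>U V f. open U \<and> open V \<and> V \<subseteq> U \<and> f \<in> sections s U \<longrightarrow>
        pullback \<Xi> V (sec_res V f) = sec_res (on_points \<Xi> -` V) (pullback \<Xi> U f)) \<and>
     (\<forall>U f. open U \<and> f \<in> sections s U \<longrightarrow>
        (even_section f \<longrightarrow> even_section (pullback \<Xi> U f)) \<and>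
        (odd_section f \<longrightarrow> odd_section (pullback \<Xi> U f))) \<and>
     (\<forall>U f g. open U \<and> f \<in> sections s U \<and> g \<in> sections s U \<longrightarrow>
        pullback \<Xi> U (sec_add f g) = sec_add (pullback \<Xi> U f) (pullback \<Xi> U g) \<and>
        pullback \<Xi> U (sec_mult f g) = sec_mult (pullback \<Xi> U f) (pullback \<Xi> U g)) \<and>
     (\<forall>U a. open U \<and> a \<in> Lam s \<longrightarrow>
        pullback \<Xi> U (sec_const U a) = sec_const (on_points \<Xi> -` U) a) \<and>
     (\<forall>U f p. open U \<and> f \<in> sections s U \<and> on_points \<Xi> p \<in> U \<and> body_at f (on_points \<Xi> p) = 0 \<longrightarrow>
        body_at (pullback \<Xi> U f) p = 0)"

definition id_supermap :: "nat \<Rightarrow> supermap" where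
  "id_supermap s = \<lparr>on_points = id,
     pullback = (\<lambda>U\<in>{U. open U}. \<lambda>f\<in>sections s U. f)\<rparr>"

definition comp_supermap :: "nat \<Rightarrow> supermap \<Rightarrow> supermap \<Rightarrow> supermap" where
  "comp_supermap s \<Xi> \<Psi> = \<lparr>on_points = on_points \<Xi> \<circ> on_points \<Psi>,
     pullback = (\<lambda>U\<in>{U. open U}. \<lambda>f\<in>sections s U.
       pullback \<Psi> (on_points \<Xi> -` U) (pullback \<Xi> U f))\<rparr>"

definition automorphism :: "nat \<Rightarrow> supermap \<Rightarrow> bool" where
  "automorphism s \<Xi> \<longleftrightarrow> morphism s \<Xi> \<and> (\<exists>\<Psi>. morphism s \<Psi> \<and>
     comp_supermap s \<Xi> \<Psi> = id_supermap s \<and> comp_supermap s \<Psi> \<Xi> = id_supermap s)"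

text \<open>The reflection \<open>\<Xi>\<^sub>-\<close> with \<open>z\<^sub>1 \<mapsto> z\<^sub>1\<close>, \<open>\<theta>\<^sub>1 \<mapsto> - \<theta>\<^sub>1\<close>, and hence \<open>z\<^sub>2 \<mapsto> z\<^sub>2\<close>, \<open>\<theta>\<^sub>2 \<mapsto> - \<theta>\<^sub>2\<close>.\<close>

definition reflection :: "nat \<Rightarrow> supermap" where
  "reflection s = \<lparr>on_points = id,
     pullback = (\<lambda>U\<in>{U. open U}. \<lambda>f\<in>sections s U. \<lambda>i z. scale_theta (-1) (f i z))\<rparr>"


section \<open>The super Riemann surface structure\<close>

text \<open>\<open>\<partial>\<^sub>z\<close> on superfunctions, and the generators
  \<open>\<partial>\<^sub>\<theta> + \<theta> \<partial>\<^sub>z\<close> and \<open>\<partial>\<^sub>\<theta> - \<theta> \<partial>\<^sub>z\<close> of the distribution in the two charts.\<close>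

lift_definition d_z :: "(complex \<Rightarrow> grassmann) \<Rightarrow> complex \<Rightarrow> grassmann"
  is "\<lambda>F z S. deriv (\<lambda>w. F w S) z" by simp

fun D_field :: "chart_index \<Rightarrow> (complex \<Rightarrow> grassmann) \<Rightarrow> complex \<Rightarrow> grassmann" where
  "D_field C1 F z = d_theta (F z) + theta * d_z F z"
| "D_field C2 F z = d_theta (F z) - theta * d_z F z"

text \<open>The sections over \<open>U\<close> of the distribution: the vector fields on \<open>U\<close>, seen as families of
  operators on the sections over the open subsets of \<open>U\<close>, that in each chart are a superfunction
  times the generator.\<close>

type_synonym vector_field = "proj_line set \<Rightarrow> ssection \<Rightarrow> ssection"

definition distribution :: "nat \<Rightarrow> proj_line set \<Rightarrow> vector_field set" where
  "distribution s U = {X \<in> (\<Pi>\<^sub>E V\<in>{V. open V \<and> V \<subseteq> U}. sections s V \<rightarrow>\<^sub>E sections s V).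
     \<forall>i. \<exists>h\<in>sections s (U \<inter> coord_patch i). \<forall>V f z.
       open V \<and> V \<subseteq> U \<and> f \<in> sections s V \<and> chart i z \<in> V \<longrightarrow>
         X V f i z = h i z * D_field i (f i) z}"

text \<open>\<open>X\<close> on the preimage of \<open>U\<close> and \<open>Y\<close> on \<open>U\<close> are related by \<open>\<Xi>\<close>; if \<open>\<Xi>\<close> is an automorphism,
  this says that \<open>Y\<close> is the push-forward of \<open>X\<close>.\<close>

definition related_by :: "nat \<Rightarrow> supermap \<Rightarrow> proj_line set \<Rightarrow> vector_field \<Rightarrow> vector_field \<Rightarrow> bool" where
  "related_by s \<Xi> U X Y \<longleftrightarrow> (\<forall>V f. open V \<and> V \<subseteq> U \<and> f \<in> sections s V \<longrightarrow>
     X (on_points \<Xi> -` V) (pullback \<Xi> V f) = pullback \<Xi> V (Y V f))"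

definition preserves_distribution :: "nat \<Rightarrow> supermap \<Rightarrow> bool" where
  "preserves_distribution s \<Xi> \<longleftrightarrow> (\<forall>U. open U \<longrightarrow>
     (\<forall>X\<in>distribution s (on_points \<Xi> -` U). \<exists>Y\<in>distribution s U. related_by s \<Xi> U X Y) \<and>
     (\<forall>Y\<in>distribution s U. \<exists>X\<in>distribution s (on_points \<Xi> -` U). related_by s \<Xi> U X Y))"

definition superconformal_automorphism :: "nat \<Rightarrow> supermap \<Rightarrow> bool" where
  "superconformal_automorphism s \<Xi> \<longleftrightarrow> automorphism s \<Xi> \<and> preserves_distribution s \<Xi>"


section \<open>Points over the base\<close>

text \<open>
  A map \<open>B \<rightarrow> \<P>\<^sup>1\<^sup>|\<^sup>1\<close>, seen as a section of \<open>\<P>\<^sup>1\<^sup>|\<^sup>1 \<times> B \<rightarrow> B\<close>: a point \<open>p\<close> and a local homomorphism of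
  superalgebras over \<open>O\<^sub>B \<otimes> \<complex>\<close>.  As the space underlying \<open>B\<close> is a single point, only neighbourhoods
  of \<open>p\<close> matter.
\<close>

record superpoint =
  under_point :: proj_line
  pt_eval :: "proj_line set \<Rightarrow> ssection \<Rightarrow> grassmann"

definition base_point :: "nat \<Rightarrow> superpoint \<Rightarrow> bool" where
  "base_point s P \<longleftrightarrow> (\<forall>U. open U \<and> under_point P \<in> U \<longrightarrow>
     pt_eval P U \<in> sections s U \<rightarrow> Lam s \<and>
     (\<forall>V f. open V \<and> under_point P \<in> V \<and> V \<subseteq> U \<and> f \<in> sections s U \<longrightarrow>
        pt_eval P V (sec_res V f) = pt_eval P U f) \<and>
     (\<forall>f\<in>sections s U. (even_section f \<longrightarrow> even_grassmann (pt_eval P U f)) \<and>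
        (odd_section f \<longrightarrow> odd_grassmann (pt_eval P U f))) \<and>
     (\<forall>f\<in>sections s U. \<forall>g\<in>sections s U.
        pt_eval P U (sec_add f g) = pt_eval P U f + pt_eval P U g \<and>
        pt_eval P U (sec_mult f g) = pt_eval P U f * pt_eval P U g) \<and>
     (\<forall>a\<in>Lam s. pt_eval P U (sec_const U a) = a) \<and>
     (\<forall>f\<in>sections s U. body_at f (under_point P) = 0 \<longrightarrow> gcoeff (pt_eval P U f) {} = 0))"

definition image_point :: "supermap \<Rightarrow> superpoint \<Rightarrow> superpoint" where
  "image_point \<Xi> P = \<lparr>under_point = on_points \<Xi> (under_point P),
     pt_eval = (\<lambda>U f. pt_eval P (on_points \<Xi> -` U) (pullback \<Xi> U f))\<rparr>"

text \<open>\<open>P\<close> is the point \<open>[Z1 : Z2 : T]\<close>, that is \<open>z\<^sub>1 = Z1 / Z2\<close>, \<open>\<theta>\<^sub>1 = T / Z2\<close> and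
  \<open>z\<^sub>2 = Z2 / Z1\<close>, \<open>\<theta>\<^sub>2 = T / Z1\<close> wherever the denominator is invertible.\<close>

definition has_coordinates ::
  "nat \<Rightarrow> superpoint \<Rightarrow> grassmann \<times> grassmann \<times> grassmann \<Rightarrow> bool" where
  "has_coordinates s P = (\<lambda>(Z1, Z2, T).
     base_point s P \<and> Z1 \<in> Lam_even s \<and> Z2 \<in> Lam_even s \<and> T \<in> Lam_odd s \<and>
     (Lam_invertible s Z1 \<or> Lam_invertible s Z2) \<and>
     (Lam_invertible s Z2 \<longrightarrow> under_point P \<in> coord_patch C1 \<and>
        pt_eval P (coord_patch C1) (z_section C1) * Z2 = Z1 \<and>
        pt_eval P (coord_patch C1) (theta_section C1) * Z2 = T) \<and>
     (Lam_invertible s Z1 \<longrightarrow> under_point P \<in> coord_patch C2 \<and>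
        pt_eval P (coord_patch C2) (z_section C2) * Z1 = Z2 \<and>
        pt_eval P (coord_patch C2) (theta_section C2) * Z1 = T))"

definition maps_point ::
  "nat \<Rightarrow> supermap \<Rightarrow> grassmann \<times> grassmann \<times> grassmann \<Rightarrow> grassmann \<times> grassmann \<times> grassmann \<Rightarrow> bool"
where
  "maps_point s \<Xi> Z Z' \<longleftrightarrow>
     (\<forall>P. has_coordinates s P Z \<longrightarrow> has_coordinates s (image_point \<Xi> P) Z')"

end

theory Submission
  imports Defs
begin

text \<open>
  Let \<open>F\<close>, \<open>G\<close> be the pull-backs of \<open>z\<^sub>1\<close>, \<open>\<theta>\<^sub>1\<close> and \<open>H\<close>, \<open>K\<close> those of \<open>z\<^sub>2\<close>, \<open>\<theta>\<^sub>2\<close>.  As the underlying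
  map is bijective and fixes \<open>0\<close> and \<open>\<infinity>\<close>, it preserves both coordinate patches, so the coefficients
  of \<open>F\<close> and \<open>G\<close> are entire functions, and \<open>F H = 1\<close>, \<open>G = K F\<close> on the overlap.  The point \<open>[1:0:0]\<close> is
  fixed, so \<open>H\<close> and \<open>K\<close> vanish at \<open>\<infinity>\<close> modulo \<open>\<theta>\<^sub>2\<close>, and \<open>z H\<close> and \<open>z K\<close>, written in the coordinates
  \<open>(z, \<theta>)\<close> of the first chart, stay bounded at \<open>\<infinity>\<close>; moreover the body of \<open>z H\<close> tends to the derivative
  at \<open>\<infinity>\<close> of the underlying injective map, which is not \<open>0\<close>.  Hence \<open>F / z\<close> and \<open>G\<close> are bounded at
  \<open>\<infinity>\<close> (\<open>Z1_growth\<close>, \<open>T1_growth\<close>), and by Liouville's theorem \<open>F = A + z B\<close> and \<open>G\<close> is constant in \<open>z\<close>.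

  Since \<open>[0:1:0]\<close> is fixed, \<open>A\<close> and \<open>G\<close> vanish modulo \<open>\<theta>\<close>; in particular \<open>G = \<theta> g\<close> with \<open>g\<close> even.  That
  the field \<open>D = \<partial>\<^sub>\<theta> + \<theta> \<partial>\<^sub>z\<close> corresponds to a multiple \<open>h D\<close> of itself gives \<open>h (D F) = G\<close> and
  \<open>h (D G) = 1\<close>, hence \<open>D F = (D G) G = \<theta> g\<^sup>2\<close>, which forces \<open>F = z g\<^sup>2\<close> (\<open>Z1_eq\<close>).  The remaining point
  gives \<open>g\<^sup>2 = 1\<close> and \<open>\<epsilon>' = \<epsilon> g\<close>.  An element with square \<open>1\<close> has body \<open>1\<close> or \<open>-1\<close>, and then equals its
  body, by induction on its coefficients (\<open>square_root_one\<close>).  So \<open>F = z\<close> and \<open>G = \<theta>\<close> or \<open>G = - \<theta>\<close>.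

  Finally, a morphism is determined by the pull-backs of the coordinates (\<open>supermap_determined\<close>):
  near a point \<open>a\<close>, every superfunction is \<open>c\<^sub>0 + \<theta> c\<^sub>1 + (z - a) q\<close> with constants \<open>c\<^sub>0\<close>, \<open>c\<^sub>1\<close> and some
  superfunction \<open>q\<close>.
\<close>

section \<open>Algebra in the Grassmann algebra\<close>

lemmas gcoeff_linear [simp] = zero_grassmann.rep_eq one_grassmann.rep_eq plus_grassmann.rep_eq
  minus_grassmann.rep_eq uminus_grassmann.rep_eq const_grassmann.rep_eq theta.rep_eq
  scale_theta.rep_eq d_theta.rep_eq d_z.rep_eq

lemma gcoeff_infinite: "infinite S \<Longrightarrow> gcoeff x S = 0"
  by transfer simp

lemma gcoeff_const_mult [simp]: "gcoeff (const_grassmann c * x) S = c * gcoeff x S"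
proof (cases "finite S")
  case True
  then have "(\<Sum>A\<in>Pow S. koszul_sign A (S - A) * (if A = {} then c else 0) * gcoeff x (S - A)) =
      (\<Sum>A\<in>{{}}. c * gcoeff x (S - A))"
    by (intro sum.mono_neutral_cong_right) auto
  then show ?thesis
    by (simp add: times_grassmann.rep_eq)
qed (simp add: gcoeff_infinite)

lemma gcoeff_mult_const [simp]: "gcoeff (x * const_grassmann c) S = c * gcoeff x S"
proof (cases "finite S")
  case True
  then have "(\<Sum>A\<in>Pow S. koszul_sign A (S - A) * gcoeff x A * (if S - A = {} then c else 0)) =
      (\<Sum>A\<in>{S}. c * gcoeff x A)"
    by (intro sum.mono_neutral_cong_right) auto
  then show ?thesis
    by (simp add: times_grassmann.rep_eq)
qed (simp add: gcoeff_infinite)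

lemma gcoeff_theta_mult [simp]:
  "gcoeff (theta * x) S = (if 0 \<in> S then gcoeff x (S - {0}) else 0)"
proof (cases "finite S")
  case True
  have sgn: "koszul_sign {0} T = 1" for T
  proof -
    have "{(a, b). a \<in> {0} \<and> b \<in> T \<and> b < (a::nat)} = {}"
      by auto
    then show ?thesis
      unfolding koszul_sign_def by (simp only: card.empty power_0)
  qed
  have "(\<Sum>A\<in>Pow S. koszul_sign A (S - A) * (if A = {0} then 1 else 0) * gcoeff x (S - A)) =
      (\<Sum>A\<in>(if 0 \<in> S then {{0}} else {}). gcoeff x (S - A))"
    using True by (intro sum.mono_neutral_cong_right) (auto simp: sgn split: if_splits)
  then show ?thesis
    by (simp add: times_grassmann.rep_eq)
qed (simp add: gcoeff_infinite)

lemma gcoeff_mult_empty [simp]: "gcoeff (x * y) {} = gcoeff x {} * gcoeff y {}"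
  by (simp add: times_grassmann.rep_eq)

lemma const_grassmann_arith:
  "const_grassmann 0 = 0" "const_grassmann 1 = 1"
  "const_grassmann (a + b) = const_grassmann a + const_grassmann b"
  "const_grassmann (a - b) = const_grassmann a - const_grassmann b"
  "const_grassmann (- a) = - const_grassmann a"
  "const_grassmann (a * b) = const_grassmann a * const_grassmann b"
  by (rule grassmann_eqI; simp)+

text \<open>Transposing \<open>e\<^sub>A\<close> and \<open>e\<^sub>B\<close> moves every generator of one past every generator of the other,
  and each of these \<open>|A| |B|\<close> pairs contributes a sign to exactly one of the two products.\<close>

lemma koszul_sign_swap:
  assumes "finite A" "finite B" "A \<inter> B = {}"
  shows "koszul_sign A B = (-1) ^ (card A * card B) * koszul_sign B A"
proof -
  let ?P = "{(a, b). a \<in> A \<and> b \<in> B \<and> b < a}" and ?Q = "{(a, b). a \<in> A \<and> b \<in> B \<and> a < b}"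
  let ?R = "{(b, a). b \<in> B \<and> a \<in> A \<and> a < b}"
  have "bij_betw prod.swap ?R ?Q"
    by (rule bij_betwI[of _ _ _ prod.swap]) auto
  then have R: "card ?R = card ?Q"
    by (rule bij_betw_same_card)
  have un: "?P \<union> ?Q = A \<times> B"
  proof -
    have "a < b \<or> b < a" if "a \<in> A" "b \<in> B" for a b
      using that assms(3) by (metis disjoint_iff linorder_neqE_nat)
    then show ?thesis
      by auto
  qed
  have fin: "finite ?P" "finite ?Q"
    using assms(1,2) by (auto intro: finite_subset[of _ "A \<times> B"])
  have disj: "?P \<inter> ?Q = {}"
    by auto
  have "(-1::complex) ^ (card A * card B) = (-1) ^ (card ?P + card ?Q)"
    by (simp only: card_Un_disjoint[OF fin disj, symmetric] un card_cartesian_product)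
  moreover have "(-1::complex) ^ m = (-1) ^ (m + n) * (-1) ^ n" for m n :: nat
    by (simp add: power_add)
  ultimately show ?thesis
    unfolding koszul_sign_def R by (simp only:)
qed

lift_definition parity_flip :: "grassmann \<Rightarrow> grassmann" is "\<lambda>f S. (-1) ^ card S * f S"
  by simp

lemmas [simp] = parity_flip.rep_eq

text \<open>The common form of both commutation rules below: \<open>k\<close> is the sign by which \<open>c\<close> passes a single
  generator, and \<open>y\<close> is \<open>x\<close> with the signs that result from moving \<open>c\<close> past it.\<close>

lemma koszul_mult_swap:
  assumes "\<And>A. finite A \<Longrightarrow> gcoeff c A \<noteq> 0 \<Longrightarrow> (-1::complex) ^ card A = k"
    and "k = 1 \<or> k = -1"
    and y: "\<And>A. gcoeff y A = k ^ card A * gcoeff x A"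
  shows "x * c = c * y"
proof (rule grassmann_eqI)
  fix S :: "nat set"
  assume S: "finite S"
  have "gcoeff (x * c) S = (\<Sum>A\<in>Pow S. koszul_sign (S - A) A * gcoeff x (S - A) * gcoeff c A)"
    unfolding times_grassmann.rep_eq
    by (rule sum.reindex_bij_witness[of _ "\<lambda>A. S - A" "\<lambda>A. S - A"]) (auto simp: double_diff)
  also have "\<dots> = gcoeff (c * y) S"
    unfolding times_grassmann.rep_eq
  proof (rule sum.cong[OF refl])
    fix A
    assume "A \<in> Pow S"
    then have fin: "finite A" "finite (S - A)"
      using S by (auto intro: finite_subset)
    show "koszul_sign (S - A) A * gcoeff x (S - A) * gcoeff c A =
        koszul_sign A (S - A) * gcoeff c A * gcoeff y (S - A)"
    proof (cases "gcoeff c A = 0")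
      case False
      then have k: "k = (-1) ^ card A"
        using assms(1) fin by blast
      have "koszul_sign (S - A) A = k ^ card (S - A) * koszul_sign A (S - A)"
        using koszul_sign_swap[of "S - A" A] fin
        by (simp add: k power_mult[symmetric] mult.commute Int_commute)
      then show ?thesis
        by (simp add: y)
    qed simp
  qed
  finally show "gcoeff (x * c) S = gcoeff (c * y) S" .
qed

lemma even_grassmann_central: "even_grassmann c \<Longrightarrow> x * c = c * x"
  by (rule koszul_mult_swap[of c 1]) (auto simp: even_grassmann_def)

lemma odd_grassmann_swap: "odd_grassmann c \<Longrightarrow> x * c = c * parity_flip x"
  by (rule koszul_mult_swap[of c "-1"]) (auto simp: odd_grassmann_def)

lemma odd_grassmann_theta: "odd_grassmann theta"
  by (simp add: odd_grassmann_def)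

lemma odd_grassmann_empty: "odd_grassmann x \<Longrightarrow> gcoeff x {} = 0"
  by (auto simp: odd_grassmann_def)

lemma odd_grassmann_square:
  assumes "odd_grassmann c"
  shows "c * c = 0"
proof -
  have "c * c = c * parity_flip c"
    using assms by (rule odd_grassmann_swap)
  also have "parity_flip c = - c"
  proof (rule grassmann_eqI)
    show "gcoeff (parity_flip c) S = gcoeff (- c) S" for S
      using assms by (cases "gcoeff c S = 0") (auto simp: odd_grassmann_def)
  qed
  finally have "c * c = - (c * c)"
    by simp
  then have "gcoeff (c * c) S = - gcoeff (c * c) S" for S
    by (metis uminus_grassmann.rep_eq)
  then show ?thesis
    by (intro grassmann_eqI) simp
qed

lemma gcoeff_mult_nonzero:
  assumes "gcoeff (x * y) S \<noteq> 0"
  obtains A where "A \<subseteq> S" "gcoeff x A \<noteq> 0" "gcoeff y (S - A) \<noteq> 0"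
proof -
  from assms obtain A where "A \<in> Pow S" "koszul_sign A (S - A) * gcoeff x A * gcoeff y (S - A) \<noteq> 0"
    unfolding times_grassmann.rep_eq by (meson sum.not_neutral_contains_not_neutral)
  then show ?thesis
    by (intro that[of A]) auto
qed

lemma gcoeff_mult_parity:
  assumes "gcoeff (x * y) S \<noteq> 0"
  obtains A B where "gcoeff x A \<noteq> 0" "gcoeff y B \<noteq> 0" "even (card S) = (even (card A) = even (card B))"
proof -
  obtain A where A: "A \<subseteq> S" "gcoeff x A \<noteq> 0" "gcoeff y (S - A) \<noteq> 0"
    using assms by (rule gcoeff_mult_nonzero)
  have "finite S"
    using assms gcoeff_infinite by blast
  then have "card S = card A + card (S - A)"
    using A(1) by (metis card_Diff_subset card_mono finite_subset le_add_diff_inverse)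
  then show ?thesis
    using A by (intro that[of A "S - A"]) auto
qed

lemma supported_mult: "x \<in> supported G \<Longrightarrow> y \<in> supported G \<Longrightarrow> x * y \<in> supported G"
  unfolding supported_def by (auto elim!: gcoeff_mult_nonzero)

lemma supported_zero: "0 \<in> supported G"
  by (simp add: supported_def)

lemma supported_const: "const_grassmann c \<in> supported G"
  by (auto simp: supported_def)

lemma supported_add: "x \<in> supported G \<Longrightarrow> y \<in> supported G \<Longrightarrow> x + y \<in> supported G"
  unfolding supported_def by (auto, metis add_cancel_right_left in_mono)

lemma supported_mono: "x \<in> supported G \<Longrightarrow> G \<subseteq> H \<Longrightarrow> x \<in> supported H"
  by (auto simp: supported_def)

lemma supported_coeff: "x \<in> supported G \<Longrightarrow> \<not> S \<subseteq> G \<Longrightarrow> gcoeff x S = 0"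
  by (auto simp: supported_def)

lemma Lam_supported: "x \<in> Lam s \<Longrightarrow> x \<in> supported {0..s}"
  by (auto simp: Lam_def elim!: supported_mono)

lemma Lam_const: "const_grassmann c \<in> Lam s" and Lam_one: "1 \<in> Lam s" and Lam_zero: "0 \<in> Lam s"
  using supported_const[of _ "{1..s}"] by (auto simp: Lam_def const_grassmann_arith(1,2)[symmetric])

lemma Lam_coeff_zero: "x \<in> Lam s \<Longrightarrow> 0 \<in> S \<Longrightarrow> gcoeff x S = 0"
  unfolding Lam_def by (erule supported_coeff) auto

text \<open>\<open>scale_theta 0\<close> removes the terms that contain \<open>\<theta>\<close>, so it is reduction modulo \<open>\<theta>\<close>.\<close>

lemma theta_decompose: "x = scale_theta 0 x + theta * d_theta x"
  by (rule grassmann_eqI) (auto simp: insert_absorb)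

lemma scale_theta_mult: "scale_theta c (x * y) = scale_theta c x * scale_theta c y"
proof (rule grassmann_eqI)
  fix S :: "nat set"
  show "gcoeff (scale_theta c (x * y)) S = gcoeff (scale_theta c x * scale_theta c y) S"
    by (auto simp: times_grassmann.rep_eq sum_distrib_left intro!: sum.cong)
qed

lemma scale_theta_add: "scale_theta c (x + y) = scale_theta c x + scale_theta c y"
  by (rule grassmann_eqI) (simp add: algebra_simps)

lemma scale_theta_scale: "scale_theta c (scale_theta d x) = scale_theta (c * d) x"
  by (rule grassmann_eqI) simp

lemma scale_theta_1 [simp]: "scale_theta 1 x = x"
  by (rule grassmann_eqI) simp

lemma scale_theta_0 [simp]: "scale_theta c 0 = 0"
  by (rule grassmann_eqI) simp

lemma scale_theta_const [simp]: "scale_theta c (const_grassmann a) = const_grassmann a"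
  by (rule grassmann_eqI) simp

lemma scale_theta_theta [simp]: "scale_theta c theta = const_grassmann c * theta"
  by (rule grassmann_eqI) simp

lemma scale_theta_Lam: "a \<in> Lam s \<Longrightarrow> scale_theta c a = a"
  by (rule grassmann_eqI) (simp add: Lam_coeff_zero)

lemma scale_theta_supported: "x \<in> supported G \<Longrightarrow> scale_theta c x \<in> supported G"
  by (auto simp: supported_def split: if_splits)

lemma scale_0_Lam: "x \<in> supported {0..s} \<Longrightarrow> scale_theta 0 x \<in> Lam s"
  unfolding Lam_def supported_def by (auto split: if_splits) (metis Suc_leI atLeastAtMost_iff not_gr_zero subsetD)+

lemma d_theta_Lam:
  assumes "x \<in> supported {0..s}" shows "d_theta x \<in> Lam s"
  unfolding Lam_def supported_def
proof safe
  fix S k assume "gcoeff (d_theta x) S \<noteq> 0" "k \<in> S"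
  then have "0 \<notin> S" "insert 0 S \<subseteq> {0..s}" using assms by (auto simp: supported_def split: if_splits)
  then show "k \<in> {1..s}" using \<open>k \<in> S\<close> by (cases k) auto
qed

text \<open>Both factors are split as \<open>x\<^sub>0 + \<theta> x\<^sub>1\<close>.  The product of the two \<open>\<theta>\<close>-parts drops out because
  \<open>\<theta>\<^sup>2 = 0\<close>, and the sign comes from moving \<open>\<theta>\<close> to the left of \<open>x\<^sub>0\<close>.\<close>

lemma d_theta_mult:
  "d_theta (x * y) = d_theta x * scale_theta 0 y + parity_flip (scale_theta 0 x) * d_theta y"
proof -
  define x0 x1 y0 y1 where "x0 = scale_theta 0 x" "x1 = d_theta x" "y0 = scale_theta 0 y" "y1 = d_theta y"
  note d = this
  have free: "scale_theta 0 (parity_flip x0) = parity_flip x0"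
    "scale_theta 0 x0 = x0" "scale_theta 0 x1 = x1" "scale_theta 0 y0 = y0" "scale_theta 0 y1 = y1"
    by (rule grassmann_eqI; simp add: d)+
  have "x * y = (x0 + theta * x1) * (y0 + theta * y1)"
    unfolding d by (metis theta_decompose)
  also have "\<dots> = x0 * y0 + (x0 * theta) * y1 + theta * x1 * y0 + theta * (x1 * theta) * y1"
    by (simp add: algebra_simps)
  also have "\<dots> = x0 * y0 + theta * (parity_flip x0 * y1 + x1 * y0) + (theta * theta) * parity_flip x1 * y1"
    by (simp only: odd_grassmann_swap[OF odd_grassmann_theta, of x0]
        odd_grassmann_swap[OF odd_grassmann_theta, of x1]) (simp add: algebra_simps)
  also have "\<dots> = scale_theta 0 (x0 * y0) + theta * scale_theta 0 (parity_flip x0 * y1 + x1 * y0)"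
    by (simp add: odd_grassmann_square[OF odd_grassmann_theta] scale_theta_mult scale_theta_add free)
  finally have "d_theta (x * y) = scale_theta 0 (parity_flip x0 * y1 + x1 * y0)"
    by (intro grassmann_eqI) auto
  then show ?thesis
    by (simp add: scale_theta_mult scale_theta_add free d[symmetric])
qed

text \<open>The substitution \<open>\<theta> \<mapsto> e\<close>, a ring homomorphism for odd \<open>e\<close>: the Leibniz rule above has the signs
  that arise from moving \<open>e\<close> to the left.\<close>

definition subst_theta :: "grassmann \<Rightarrow> grassmann \<Rightarrow> grassmann" where
  "subst_theta e x = scale_theta 0 x + e * d_theta x"

lemma d_theta_add: "d_theta (x + y) = d_theta x + d_theta y"
  by (rule grassmann_eqI) simp

lemma subst_theta_add: "subst_theta e (x + y) = subst_theta e x + subst_theta e y"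
  by (simp add: subst_theta_def d_theta_add scale_theta_add algebra_simps)

lemma subst_theta_mult:
  assumes "odd_grassmann e"
  shows "subst_theta e (x * y) = subst_theta e x * subst_theta e y"
proof -
  have "subst_theta e x * subst_theta e y = scale_theta 0 x * scale_theta 0 y +
      (scale_theta 0 x * e) * d_theta y + e * d_theta x * scale_theta 0 y +
      e * (d_theta x * e) * d_theta y"
    by (simp add: subst_theta_def algebra_simps)
  also have "\<dots> = scale_theta 0 x * scale_theta 0 y + e * d_theta (x * y) +
      (e * e) * parity_flip (d_theta x) * d_theta y"
    by (simp only: odd_grassmann_swap[OF assms, of "scale_theta 0 x"]
        odd_grassmann_swap[OF assms, of "d_theta x"]) (simp add: d_theta_mult algebra_simps)
  finally show ?thesis
    by (simp add: odd_grassmann_square[OF assms] subst_theta_def scale_theta_mult)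
qed

lemma d_theta_Lam_zero: "a \<in> Lam s \<Longrightarrow> d_theta a = 0"
  by (rule grassmann_eqI) (simp add: Lam_coeff_zero)

lemma subst_theta_Lam: "a \<in> Lam s \<Longrightarrow> subst_theta e a = a"
  by (simp add: subst_theta_def scale_theta_Lam d_theta_Lam_zero)

lemma subst_theta_theta: "subst_theta e theta = e"
proof -
  have "d_theta theta = 1" "scale_theta 0 theta = 0"
    by (rule grassmann_eqI; simp; blast)+
  then show ?thesis
    by (simp add: subst_theta_def)
qed

lemma subst_theta_0: "subst_theta 0 x = scale_theta 0 x"
  by (simp add: subst_theta_def)

lemma subst_theta_supported: "e \<in> Lam s \<Longrightarrow> x \<in> supported {0..s} \<Longrightarrow> subst_theta e x \<in> Lam s"
  unfolding subst_theta_def using scale_0_Lam d_theta_Lam supported_add supported_mult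
  unfolding Lam_def by blast

lemma subst_theta_empty: "odd_grassmann e \<Longrightarrow> gcoeff (subst_theta e x) {} = gcoeff x {}"
  by (simp add: subst_theta_def odd_grassmann_empty)

lemma subst_theta_even:
  assumes "odd_grassmann e" "even_grassmann x"
  shows "even_grassmann (subst_theta e x)"
proof -
  { fix S assume "gcoeff (e * d_theta x) S \<noteq> 0"
    then obtain A B where AB: "gcoeff e A \<noteq> 0" "gcoeff (d_theta x) B \<noteq> 0" "even (card S) = (even (card A) = even (card B))"
      by (rule gcoeff_mult_parity)
    have "finite B"
      using AB(2) gcoeff_infinite by blast
    moreover have B: "0 \<notin> B" "gcoeff x (insert 0 B) \<noteq> 0"
      using AB(2) by (auto split: if_splits)
    moreover have "even (card (insert 0 B))"
      using B(2) assms(2) unfolding even_grassmann_def by blast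
    ultimately have "odd (card B)"
      by simp
    moreover have "odd (card A)"
      using AB(1) assms(1) unfolding odd_grassmann_def by blast
    ultimately have "even (card S)"
      using AB(3) by simp }
  moreover have "gcoeff (scale_theta 0 x) S \<noteq> 0 \<Longrightarrow> even (card S)" for S
    using assms(2) by (auto simp: even_grassmann_def split: if_splits)
  ultimately show ?thesis
    unfolding even_grassmann_def subst_theta_def plus_grassmann.rep_eq by (metis add_cancel_right_left)
qed

lemma subst_theta_odd:
  assumes "odd_grassmann e" "odd_grassmann x"
  shows "odd_grassmann (subst_theta e x)"
proof -
  { fix S assume "gcoeff (e * d_theta x) S \<noteq> 0"
    then obtain A B where AB: "gcoeff e A \<noteq> 0" "gcoeff (d_theta x) B \<noteq> 0" "even (card S) = (even (card A) = even (card B))"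
      by (rule gcoeff_mult_parity)
    have "finite B"
      using AB(2) gcoeff_infinite by blast
    moreover have B: "0 \<notin> B" "gcoeff x (insert 0 B) \<noteq> 0"
      using AB(2) by (auto split: if_splits)
    moreover have "odd (card (insert 0 B))"
      using B(2) assms(2) unfolding odd_grassmann_def by blast
    ultimately have "even (card B)"
      by simp
    moreover have "odd (card A)"
      using AB(1) assms(1) unfolding odd_grassmann_def by blast
    ultimately have "odd (card S)"
      using AB(3) by simp }
  moreover have "gcoeff (scale_theta 0 x) S \<noteq> 0 \<Longrightarrow> odd (card S)" for S
    using assms(2) by (auto simp: odd_grassmann_def split: if_splits)
  ultimately show ?thesis
    unfolding odd_grassmann_def subst_theta_def plus_grassmann.rep_eq by (metis add_cancel_right_left)
qed

text \<open>If the body of \<open>x\<close> is \<open>1\<close>, then \<open>n = x - 1\<close> satisfies \<open>n\<^sup>2 = - 2 n\<close> and has no constant term, so the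
  coefficient of \<open>n\<close> at \<open>S\<close> is a combination of products of coefficients at proper subsets of \<open>S\<close>.  By
  induction on \<open>S\<close> all of them vanish.\<close>

lemma square_root_one:
  fixes x :: grassmann
  assumes "x * x = 1"
  shows "x = 1 \<or> x = - 1"
proof -
  have unique: "y = 1" if y: "y * y = 1" "gcoeff y {} = 1" for y :: grassmann
  proof -
    define n where "n = y - 1"
    have n: "n * n = - n - n"
      using y(1) by (simp add: n_def algebra_simps)
    have n0: "gcoeff n {} = 0"
      using y(2) by (simp add: n_def)
    have "gcoeff n S = 0" if "finite S" for S
      using that
    proof (induction "card S" arbitrary: S rule: less_induct)
      case less
      have "gcoeff (n * n) S = 0"
        unfolding times_grassmann.rep_eq
      proof (rule sum.neutral, safe)
        fix A assume "A \<subseteq> S"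
        then show "koszul_sign A (S - A) * gcoeff n A * gcoeff n (S - A) = 0"
          using less n0 by (cases "A = S") (auto simp: psubset_card_mono finite_subset)
      qed
      then show ?case
        using n by simp
    qed
    then show "y = 1"
      by (intro grassmann_eqI) (auto simp: n_def)
  qed
  have "gcoeff x {} * gcoeff x {} = 1"
    using assms by (metis gcoeff_mult_empty one_grassmann.rep_eq)
  then have "gcoeff x {} = 1 \<or> gcoeff x {} = -1"
    by (simp add: square_eq_1_iff)
  then show ?thesis
    using unique[of x] unique[of "- x"] assms by (auto simp: minus_equation_iff)
qed


section \<open>Sections over open subsets of the projective line\<close>

lemma coord_patch_eq: "coord_patch C1 = - {Infty}" "coord_patch C2 = - {Aff 0}"
proof -
  have "Aff z \<in> range (chart C2)" if "z \<noteq> 0" for z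
    using that by (intro range_eqI[of _ _ "1 / z"]) simp
  moreover have "Infty \<in> range (chart C2)"
    by (intro range_eqI[of _ _ 0]) simp
  moreover have "p \<noteq> Infty \<Longrightarrow> p \<in> range (chart C1)" for p
    by (cases p) auto
  moreover have "p \<noteq> Aff 0 \<Longrightarrow> p \<in> range (chart C2)" for p
    using calculation by (cases p) auto
  ultimately show "coord_patch C1 = - {Infty}" "coord_patch C2 = - {Aff 0}"
    unfolding coord_patch_def by (auto split: if_splits)
qed

lemma chart_swap: "z \<noteq> 0 \<Longrightarrow> i \<noteq> j \<Longrightarrow> chart i z = chart j (1 / z)"
  by (cases i; cases j) auto

lemma chart_in_patch: "chart i z \<in> coord_patch j \<longleftrightarrow> i = j \<or> z \<noteq> 0"
  by (cases i; cases j) (auto simp: coord_patch_eq)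

lemma chart_vimage_patch: "chart i -` coord_patch i = UNIV"
  by (auto simp: chart_in_patch simp del: chart.simps)

lemma inj_chart: "chart i z = chart i w \<longleftrightarrow> z = w"
  by (cases i) auto

lemma open_chart_vimage: "open U \<Longrightarrow> open (chart i -` U)"
  by (simp add: open_proj_line_def)

lemma open_coord_patch: "open (coord_patch i)"
  unfolding open_proj_line_def
proof
  fix j
  have "chart j -` coord_patch i = (if i = j then UNIV else - {0})"
    by (auto simp: chart_in_patch)
  then show "open (chart j -` coord_patch i)"
    by auto
qed

lemma section_supported: "f \<in> sections s U \<Longrightarrow> f i z \<in> supported {0..s}"
  and section_holomorphic: "f \<in> sections s U \<Longrightarrow> (\<lambda>z. gcoeff (f i z) S) holomorphic_on (chart i -` U)"
  and section_outside: "f \<in> sections s U \<Longrightarrow> chart i z \<notin> U \<Longrightarrow> f i z = 0"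
  by (simp_all add: sections_def)

lemma section_transform:
  assumes "f \<in> sections s U" "i \<noteq> j" "z \<noteq> 0"
  shows "f i z = scale_theta (1 / z) (f j (1 / z))"
proof -
  have 1: "f C1 w = scale_theta (1 / w) (f C2 (1 / w))" if "w \<noteq> 0" for w
    using assms(1) that by (simp add: sections_def)
  have "f C2 z = scale_theta (1 / z) (f C1 (1 / z))"
    using 1[of "1 / z"] assms(3) by (simp add: scale_theta_scale)
  then show ?thesis
    using 1[OF assms(3)] assms(2) by (metis chart_index.exhaust)
qed

text \<open>The section over a part \<open>V\<close> of a coordinate patch given by a superfunction in that patch.\<close>

definition local_section :: "chart_index \<Rightarrow> proj_line set \<Rightarrow> (complex \<Rightarrow> grassmann) \<Rightarrow> ssection" where
  "local_section i V g = (\<lambda>j z. if chart j z \<in> V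
     then if j = i then g z else scale_theta (1 / z) (g (1 / z)) else 0)"

lemma local_section_apply: "chart i z \<in> V \<Longrightarrow> local_section i V g i z = g z"
  by (simp add: local_section_def)

lemma local_section_in:
  assumes V: "open V" "V \<subseteq> coord_patch i"
    and supp: "\<And>z. chart i z \<in> V \<Longrightarrow> g z \<in> supported {0..s}"
    and hol: "\<And>S. (\<lambda>z. gcoeff (g z) S) holomorphic_on (chart i -` V)"
  shows "local_section i V g \<in> sections s V"
proof -
  have nz: "z \<noteq> 0" "chart i (1 / z) \<in> V" if "chart j z \<in> V" "j \<noteq> i" for j z
  proof -
    show "z \<noteq> 0"
      using that V(2) chart_in_patch[of j z i] by auto
    then show "chart i (1 / z) \<in> V"
      using that chart_swap by metis
  qed
  have "local_section i V g j z \<in> supported {0..s}" for j z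
    using supp nz by (auto simp: local_section_def supported_zero intro!: scale_theta_supported)
  moreover have "(\<lambda>z. gcoeff (local_section i V g j z) S) holomorphic_on (chart j -` V)" for j S
  proof (cases "j = i")
    case True
    show ?thesis
      unfolding True by (rule holomorphic_transform[OF hol[of S]]) (simp add: local_section_def)
  next
    case False
    have "(\<lambda>z. gcoeff (g z) S) \<circ> (\<lambda>z. 1 / z) holomorphic_on (chart j -` V)"
      using nz False by (intro holomorphic_on_compose_gen[OF _ hol] holomorphic_intros) auto
    then have "(\<lambda>z. (if 0 \<in> S then 1 / z else 1) * gcoeff (g (1 / z)) S) holomorphic_on (chart j -` V)"
      using nz False by (cases "0 \<in> S") (auto simp: o_def intro!: holomorphic_intros)
    then show ?thesis
      by (rule holomorphic_transform) (use False in \<open>auto simp: local_section_def\<close>)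
  qed
  moreover have "local_section i V g C1 z = scale_theta (1 / z) (local_section i V g C2 (1 / z))"
    if "z \<noteq> 0" for z
    using that by (cases i) (auto simp: local_section_def scale_theta_scale)
  ultimately show ?thesis
    by (auto simp: sections_def local_section_def)
qed

lemma local_section_eq:
  assumes "V \<subseteq> coord_patch i" "f \<in> sections s V" "\<And>z. chart i z \<in> V \<Longrightarrow> f i z = g z"
  shows "f = local_section i V g"
proof (intro ext)
  fix j z
  show "f j z = local_section i V g j z"
  proof (cases "chart j z \<in> V \<and> j \<noteq> i")
    case True
    then have "z \<noteq> 0"
      using assms(1) chart_in_patch[of j z i] by auto
    then show ?thesis
      using True assms section_transform[OF assms(2), of j i z] chart_swap[of z j i]
      by (simp add: local_section_def)
  qed (auto simp: local_section_def assms section_outside[OF assms(2)])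
qed

lemma section_eq_on_patch:
  assumes "V \<subseteq> coord_patch i" "f \<in> sections s V" "g \<in> sections s V"
    and "\<And>z. chart i z \<in> V \<Longrightarrow> f i z = g i z"
  shows "f = g"
  using local_section_eq[OF assms(1,2), of "g i"] local_section_eq[OF assms(1,3), of "g i"] assms(4)
  by simp

text \<open>The first chart misses only the point at infinity, where continuity decides.\<close>

lemma section_eqI:
  assumes U: "open U" and f: "f \<in> sections s U" and g: "g \<in> sections s U"
    and eq: "\<And>z. Aff z \<in> U \<Longrightarrow> f C1 z = g C1 z"
  shows "f = g"
proof -
  have C1: "f C1 z = g C1 z" for z
    using eq section_outside[OF f, of C1 z] section_outside[OF g, of C1 z] by (cases "Aff z \<in> U") auto
  have C2: "f C2 z = g C2 z" if "z \<noteq> 0" for z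
    using section_transform[OF f, of C2 C1 z] section_transform[OF g, of C2 C1 z] C1 that by simp
  have "f C2 0 = g C2 0"
  proof (cases "Infty \<in> U")
    case True
    show ?thesis
    proof (rule grassmann_eqI)
      fix S :: "nat set"
      have op: "open (chart C2 -` U)" "0 \<in> chart C2 -` U"
        using open_chart_vimage[OF U, of C2] True by auto
      have lim: "(\<lambda>z. gcoeff (h C2 z) S) \<midarrow>0\<rightarrow> gcoeff (h C2 0) S" if "h \<in> sections s U" for h
        using section_holomorphic[OF that, of C2 S] op
        by (metis continuous_on_eq_continuous_at holomorphic_on_imp_continuous_on isCont_def)
      have "(\<lambda>z. gcoeff (f C2 z) S) \<midarrow>0\<rightarrow> gcoeff (g C2 0) S"
        using lim[OF g] by (rule Lim_transform_eventually) (auto simp: eventually_at_filter C2)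
      with lim[OF f] show "gcoeff (f C2 0) S = gcoeff (g C2 0) S"
        by (rule tendsto_unique[rotated 1]) simp
    qed
  next
    case False
    then show ?thesis
      using section_outside[OF f, of C2 0] section_outside[OF g, of C2 0] by simp
  qed
  with C1 C2 show ?thesis
    by (intro ext) (metis chart_index.exhaust)
qed

lemma body_at_chart:
  assumes "f \<in> sections s U"
  shows "body_at f (chart i z) = gcoeff (f i z) {}"
  using section_transform[OF assms, of C2 C1 z] by (cases i; cases "z = 0") auto

lemma sec_const_in:
  assumes "open U" "a \<in> Lam s"
  shows "sec_const U a \<in> sections s U"
proof -
  have "(\<lambda>z. gcoeff (sec_const U a i z) S) holomorphic_on (chart i -` U)" for i S
    by (rule holomorphic_transform[of "\<lambda>_. gcoeff a S"]) (auto simp: sec_const_def)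
  then show ?thesis
    using assms by (auto simp: sections_def sec_const_def supported_zero Lam_supported scale_theta_Lam)
qed

lemma sec_add_in: "f \<in> sections s U \<Longrightarrow> g \<in> sections s U \<Longrightarrow> sec_add f g \<in> sections s U"
  unfolding sections_def sec_add_def
  by (auto simp: supported_add scale_theta_add intro!: holomorphic_intros)

lemma sec_mult_in: "f \<in> sections s U \<Longrightarrow> g \<in> sections s U \<Longrightarrow> sec_mult f g \<in> sections s U"
  unfolding sections_def sec_mult_def
  by (auto simp: supported_mult scale_theta_mult times_grassmann.rep_eq intro!: holomorphic_intros)

lemma sec_res_in:
  assumes "f \<in> sections s U" "V \<subseteq> U"
  shows "sec_res V f \<in> sections s V"
proof -
  have "(\<lambda>z. gcoeff (sec_res V f i z) S) holomorphic_on (chart i -` V)" for i S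
    by (rule holomorphic_transform[OF holomorphic_on_subset[OF section_holomorphic[OF assms(1), of i S]]])
      (use assms(2) in \<open>auto simp: sec_res_def\<close>)
  then show ?thesis
    using assms(1) by (auto simp: sections_def sec_res_def supported_zero)
qed

lemma theta_supported: "theta \<in> supported {0..s}"
  by (auto simp: supported_def)

lemma z_section_in: "z_section i \<in> sections s (coord_patch i)"
proof -
  have "local_section i (coord_patch i) const_grassmann = z_section i"
    by (intro ext) (auto simp: local_section_def z_section_def chart_in_patch)
  moreover have "local_section i (coord_patch i) const_grassmann \<in> sections s (coord_patch i)"
  proof (rule local_section_in)
    show "(\<lambda>z. gcoeff (const_grassmann z) S) holomorphic_on (chart i -` coord_patch i)" for S
      by (cases "S = {}") (auto intro!: holomorphic_intros)
  qed (auto simp: open_coord_patch supported_const)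
  ultimately show ?thesis
    by simp
qed

lemma theta_section_in: "theta_section i \<in> sections s (coord_patch i)"
proof -
  have "local_section i (coord_patch i) (\<lambda>_. theta) = theta_section i"
    by (intro ext) (auto simp: local_section_def theta_section_def chart_in_patch)
  moreover have "local_section i (coord_patch i) (\<lambda>_. theta) \<in> sections s (coord_patch i)"
    by (rule local_section_in) (auto simp: open_coord_patch theta_supported simp del: theta.rep_eq)
  ultimately show ?thesis
    by simp
qed


section \<open>Evaluation at points over the base\<close>

text \<open>Evaluation at \<open>z\<^sub>i = z\<close>, \<open>\<theta>\<^sub>i = e\<close>.  The value of \<open>z\<^sub>i\<close> is a complex number, without a nilpotent part, so
  no Taylor expansion is involved; this covers the three given points.\<close>

definition eval_point :: "chart_index \<Rightarrow> complex \<Rightarrow> grassmann \<Rightarrow> superpoint" where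
  "eval_point i z e = \<lparr>under_point = chart i z, pt_eval = (\<lambda>U f. subst_theta e (f i z))\<rparr>"

lemma base_point_eval_point:
  assumes "e \<in> Lam_odd s"
  shows "base_point s (eval_point i z e)"
proof -
  have e: "e \<in> Lam s" "odd_grassmann e"
    using assms by (auto simp: Lam_odd_def)
  show ?thesis
    unfolding base_point_def eval_point_def
    by (auto simp: subst_theta_supported[OF e(1)] section_supported sec_res_def even_section_def
        odd_section_def subst_theta_even[OF e(2)] subst_theta_odd[OF e(2)] sec_add_def sec_mult_def
        subst_theta_add subst_theta_mult[OF e(2)] sec_const_def subst_theta_Lam
        subst_theta_empty[OF e(2)] body_at_chart simp del: chart.simps)
qed

lemma Lam_odd_zero: "0 \<in> Lam_odd s" and Lam_even_zero: "0 \<in> Lam_even s"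
  and Lam_even_one: "1 \<in> Lam_even s"
  by (auto simp: Lam_odd_def Lam_even_def Lam_zero Lam_one odd_grassmann_def even_grassmann_def)

lemma Lam_invertible_one: "Lam_invertible s 1" and not_Lam_invertible_zero: "\<not> Lam_invertible s 0"
  by (auto simp: Lam_invertible_def Lam_one)

lemma has_coordinates_eval_point:
  "has_coordinates s (eval_point C1 0 0) (0, 1, 0)"
  "has_coordinates s (eval_point C2 0 0) (1, 0, 0)"
  "e \<in> Lam_odd s \<Longrightarrow> has_coordinates s (eval_point C1 1 e) (1, 1, e)"
  by (simp_all add: has_coordinates_def base_point_eval_point Lam_odd_zero Lam_even_zero
      Lam_even_one Lam_invertible_one not_Lam_invertible_zero coord_patch_eq)
    (simp_all add: eval_point_def z_section_def theta_section_def subst_theta_theta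
      const_grassmann_arith subst_theta_Lam[OF Lam_zero] subst_theta_Lam[OF Lam_one])


section \<open>The distribution in the first chart\<close>

lemma gcoeff_D_field:
  "gcoeff (D_field C1 F z) S =
    (if 0 \<in> S then deriv (\<lambda>w. gcoeff (F w) (S - {0})) z else gcoeff (F z) (insert 0 S))"
  "gcoeff (D_field C2 F z) S =
    (if 0 \<in> S then - deriv (\<lambda>w. gcoeff (F w) (S - {0})) z else gcoeff (F z) (insert 0 S))"
  by simp_all

definition D_vector_field :: "nat \<Rightarrow> vector_field" where
  "D_vector_field s = (\<lambda>V\<in>{V. open V \<and> V \<subseteq> coord_patch C1}. \<lambda>f\<in>sections s V.
     local_section C1 V (D_field C1 (f C1)))"

lemma D_field_section_in:
  assumes V: "open V" "V \<subseteq> coord_patch C1" and f: "f \<in> sections s V"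
  shows "local_section C1 V (D_field C1 (f C1)) \<in> sections s V"
proof (rule local_section_in[OF V])
  fix z
  show "D_field C1 (f C1) z \<in> supported {0..s}"
  proof -
    have "gcoeff (D_field C1 (f C1) z) S = 0" if S: "\<not> S \<subseteq> {0..s}" for S
    proof -
      have "gcoeff (f C1 w) (S - {0}) = 0" "gcoeff (f C1 w) (insert 0 S) = 0" for w
        using S by (auto intro!: supported_coeff[OF section_supported[OF f]])
      then show ?thesis
        by (simp add: gcoeff_D_field del: D_field.simps)
    qed
    then show ?thesis
      unfolding supported_def by blast
  qed
next
  fix S :: "nat set"
  have "(\<lambda>z. gcoeff (f C1 z) T) holomorphic_on chart C1 -` V" for T
    by (rule section_holomorphic[OF f])
  then show "(\<lambda>z. gcoeff (D_field C1 (f C1) z) S) holomorphic_on chart C1 -` V"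
    unfolding gcoeff_D_field using open_chart_vimage[OF V(1)]
    by (cases "0 \<in> S") (auto intro!: holomorphic_intros)
qed

text \<open>On the overlap, \<open>\<partial>\<^sub>\<theta>\<^sub>1 + \<theta>\<^sub>1 \<partial>\<^sub>z\<^sub>1 = z\<^sub>2 (\<partial>\<^sub>\<theta>\<^sub>2 - \<theta>\<^sub>2 \<partial>\<^sub>z\<^sub>2)\<close>: the \<open>\<partial>\<^sub>\<theta>\<close>-part picks up the factor
  \<open>1 / z\<^sub>1\<close> of \<open>\<theta>\<^sub>2 = \<theta>\<^sub>1 / z\<^sub>1\<close>, and the \<open>\<partial>\<^sub>z\<close>-part the derivative \<open>- z\<^sub>2\<^sup>2\<close> of \<open>1 / z\<^sub>1\<close>.\<close>

lemma D_field_chart_change: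
  assumes V: "open V" and f: "f \<in> sections s V" and z: "chart C2 z \<in> V" "z \<noteq> 0"
  shows "scale_theta (1 / z) (D_field C1 (f C1) (1 / z)) = const_grassmann z * D_field C2 (f C2) z"
proof (rule grassmann_eqI)
  fix S :: "nat set"
  have f1: "f C1 w = scale_theta (1 / w) (f C2 (1 / w))" if "w \<noteq> 0" for w
    using section_transform[OF f _ that] by simp
  show "gcoeff (scale_theta (1 / z) (D_field C1 (f C1) (1 / z))) S =
      gcoeff (const_grassmann z * D_field C2 (f C2) z) S"
  proof (cases "0 \<in> S")
    case True
    let ?T = "S - {0}"
    define h where "h = (\<lambda>w. gcoeff (f C2 w) ?T)"
    have "h holomorphic_on chart C2 -` V"
      unfolding h_def by (rule section_holomorphic[OF f])
    then have h: "(h has_field_derivative deriv h z) (at (1 / (1 / z)))"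
      using z open_chart_vimage[OF V] by (simp add: holomorphic_derivI)
    have "((\<lambda>w. h (1 / w)) has_field_derivative deriv h z * (- (z * z))) (at (1 / z))"
      using z(2) by (intro DERIV_chain2[where g = "\<lambda>w. 1 / w", OF h]) (auto intro!: derivative_eq_intros simp: field_simps)
    moreover have ev: "eventually (\<lambda>w. h (1 / w) = gcoeff (f C1 w) ?T) (nhds (1 / z))"
    proof (rule eventually_nhds_in_open[of "- {0}", THEN eventually_mono])
      show "h (1 / w) = gcoeff (f C1 w) ?T" if "w \<in> - {0}" for w
        using that by (simp add: h_def f1)
    qed (use z in auto)
    ultimately have "((\<lambda>w. gcoeff (f C1 w) ?T) has_field_derivative deriv h z * (- (z * z))) (at (1 / z))"
      using DERIV_cong_ev[OF refl ev refl] by blast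
    then have "deriv (\<lambda>w. gcoeff (f C1 w) ?T) (1 / z) = deriv h z * (- (z * z))"
      by (rule DERIV_imp_deriv)
    then show ?thesis
      using True z by (simp add: gcoeff_D_field h_def del: D_field.simps)
  next
    case False
    then show ?thesis
      using z(2) by (simp add: gcoeff_D_field f1 del: D_field.simps)
  qed
qed

lemma D_vector_field_in_distribution: "D_vector_field s \<in> distribution s (coord_patch C1)"
proof -
  have "\<exists>h\<in>sections s (coord_patch C1 \<inter> coord_patch i). \<forall>V f z.
      open V \<and> V \<subseteq> coord_patch C1 \<and> f \<in> sections s V \<and> chart i z \<in> V \<longrightarrow>
      D_vector_field s V f i z = h i z * D_field i (f i) z" for i
  proof (cases i)
    case C1
    show ?thesis
    proof (intro bexI allI impI)
      show "sec_const (coord_patch C1) 1 \<in> sections s (coord_patch C1 \<inter> coord_patch i)"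
        using C1 by (simp add: sec_const_in open_coord_patch Lam_one)
    next
      fix V f z
      assume "open V \<and> V \<subseteq> coord_patch C1 \<and> f \<in> sections s V \<and> chart i z \<in> V"
      then show "D_vector_field s V f i z = sec_const (coord_patch C1) 1 i z * D_field i (f i) z"
        using C1 by (auto simp: D_vector_field_def local_section_def sec_const_def
            simp del: D_field.simps)
    qed
  next
    case C2
    show ?thesis
    proof (intro bexI allI impI)
      show "sec_res (coord_patch C1 \<inter> coord_patch i) (z_section C2) \<in>
          sections s (coord_patch C1 \<inter> coord_patch i)"
        using C2 by (intro sec_res_in[OF z_section_in]) auto
    next
      fix V f z
      assume a: "open V \<and> V \<subseteq> coord_patch C1 \<and> f \<in> sections s V \<and> chart i z \<in> V"
      then have "chart C2 z \<in> V" "z \<noteq> 0"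
        using C2 chart_in_patch[of C2 z C1] by auto
      then show "D_vector_field s V f i z =
          sec_res (coord_patch C1 \<inter> coord_patch i) (z_section C2) i z * D_field i (f i) z"
        using C2 a D_field_chart_change[of V f s z]
        by (auto simp: D_vector_field_def local_section_def sec_res_def z_section_def chart_in_patch
            simp del: D_field.simps chart.simps)
    qed
  qed
  moreover have "D_vector_field s \<in>
      (\<Pi>\<^sub>E V\<in>{V. open V \<and> V \<subseteq> coord_patch C1}. sections s V \<rightarrow>\<^sub>E sections s V)"
    using D_field_section_in by (auto simp: D_vector_field_def)
  ultimately show ?thesis
    unfolding distribution_def by blast
qed


section \<open>Growth at infinity\<close>

lemma entire_polynomial_growth:
  fixes f :: "complex \<Rightarrow> complex"
  assumes "f holomorphic_on UNIV" "(\<lambda>z. f z / z ^ n) \<in> O[at_infinity](\<lambda>_. 1)"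
  shows "f z = (\<Sum>k\<le>n. (deriv ^^ k) f 0 / fact k * z ^ k)"
proof -
  obtain c where "eventually (\<lambda>z. norm (f z / z ^ n) \<le> c * norm (1::complex)) at_infinity"
    using assms(2) by (elim landau_o.bigE)
  then obtain b where b: "\<And>z. norm z \<ge> b \<Longrightarrow> norm (f z / z ^ n) \<le> c"
    by (auto simp: eventually_at_infinity)
  show ?thesis
  proof (rule Liouville_polynomial[OF assms(1), of "max b 1" c])
    fix z :: complex
    assume z: "max b 1 \<le> norm z"
    then have "norm (f z) / norm z ^ n \<le> c" "norm z ^ n > 0"
      using b[of z] by (auto simp: norm_divide norm_power intro!: zero_less_power)
    then show "norm (f z) \<le> c * norm z ^ n"
      by (simp add: field_simps)
  qed
qed

definition bounded_at_infinity :: "(complex \<Rightarrow> grassmann) \<Rightarrow> bool" where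
  "bounded_at_infinity F \<longleftrightarrow> (\<forall>S. (\<lambda>z. gcoeff (F z) S) \<in> O[at_infinity](\<lambda>_. 1))"

lemma bounded_at_infinity_const: "bounded_at_infinity (\<lambda>_. c)"
  by (simp add: bounded_at_infinity_def)

lemma bounded_at_infinity_cong:
  assumes F: "bounded_at_infinity F" and eq: "\<And>z. z \<noteq> 0 \<Longrightarrow> F z = G z"
  shows "bounded_at_infinity G"
  unfolding bounded_at_infinity_def
proof
  fix S
  have "eventually (\<lambda>z. gcoeff (F z) S = gcoeff (G z) S) at_infinity"
    using eventually_not_equal_at_infinity[of 0] by eventually_elim (simp add: eq)
  from landau_o.big.in_cong[OF this] show "(\<lambda>z. gcoeff (G z) S) \<in> O[at_infinity](\<lambda>_. 1)"
    using F[unfolded bounded_at_infinity_def, THEN spec[of _ S]] by (rule iffD1)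
qed

lemma bounded_at_infinity_mult:
  assumes "bounded_at_infinity F" "bounded_at_infinity E"
  shows "bounded_at_infinity (\<lambda>z. F z * E z)"
proof -
  have "(\<lambda>z. koszul_sign A B * gcoeff (F z) A * gcoeff (E z) B) \<in> O[at_infinity](\<lambda>_. 1)" for A B
  proof -
    have "(\<lambda>z. gcoeff (F z) A * gcoeff (E z) B) \<in> O[at_infinity](\<lambda>_. 1 * 1)"
      using assms unfolding bounded_at_infinity_def by (intro landau_o.big.mult) auto
    then show ?thesis
      by (simp add: mult.assoc)
  qed
  then show ?thesis
    unfolding bounded_at_infinity_def times_grassmann.rep_eq by (auto intro!: big_sum_in_bigo)
qed

text \<open>Division by a function whose body stays away from \<open>0\<close>, without forming its inverse: the
  coefficient of \<open>F E\<close> at \<open>S\<close> is the coefficient of \<open>F\<close> at \<open>S\<close> times the body of \<open>E\<close>, plus terms that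
  involve \<open>F\<close> only at proper subsets of \<open>S\<close>.\<close>

lemma bounded_at_infinity_quotient:
  assumes FE: "bounded_at_infinity (\<lambda>z. F z * E z)" and E: "bounded_at_infinity E"
    and body: "((\<lambda>z. gcoeff (E z) {}) \<longlongrightarrow> l) at_infinity" "l \<noteq> 0"
  shows "bounded_at_infinity F"
proof -
  have inv: "(\<lambda>z. inverse (gcoeff (E z) {})) \<in> O[at_infinity](\<lambda>_. 1)"
    using tendsto_inverse[OF body] by (intro bigoI_tendsto[of _ _ "inverse l"]) auto
  have nz: "eventually (\<lambda>z. gcoeff (E z) {} \<noteq> 0) at_infinity"
    using tendsto_imp_eventually_ne[OF body] .
  have "(\<lambda>z. gcoeff (F z) S) \<in> O[at_infinity](\<lambda>_. 1)" if "finite S" for S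
    using that
  proof (induction "card S" arbitrary: S rule: less_induct)
    case less
    let ?R = "\<lambda>z. \<Sum>A\<in>Pow S - {S}. koszul_sign A (S - A) * gcoeff (F z) A * gcoeff (E z) (S - A)"
    have split: "gcoeff (F z * E z) S = gcoeff (F z) S * gcoeff (E z) {} + ?R z" for z
      unfolding times_grassmann.rep_eq using less.prems
      by (subst sum.remove[of _ S]) auto
    have "?R \<in> O[at_infinity](\<lambda>_. 1)"
    proof (rule big_sum_in_bigo)
      fix A
      assume "A \<in> Pow S - {S}"
      then have "A \<subset> S"
        by auto
      then have "(\<lambda>z. gcoeff (F z) A) \<in> O[at_infinity](\<lambda>_. 1)"
        using less.prems by (intro less.hyps psubset_card_mono) (auto intro: finite_subset)
      then have "(\<lambda>z. gcoeff (F z) A * gcoeff (E z) (S - A)) \<in> O[at_infinity](\<lambda>_. 1 * 1)"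
        using E unfolding bounded_at_infinity_def by (intro landau_o.big.mult) auto
      then show "(\<lambda>z. koszul_sign A (S - A) * gcoeff (F z) A * gcoeff (E z) (S - A))
          \<in> O[at_infinity](\<lambda>_. 1)"
        by (simp add: mult.assoc)
    qed
    then have "(\<lambda>z. gcoeff (F z * E z) S - ?R z) \<in> O[at_infinity](\<lambda>_. 1)"
      using FE unfolding bounded_at_infinity_def by (intro sum_in_bigo) auto
    then have "(\<lambda>z. gcoeff (F z) S * gcoeff (E z) {}) \<in> O[at_infinity](\<lambda>_. 1)"
      by (simp only: split add_diff_cancel_right')
    then have "(\<lambda>z. gcoeff (F z) S * gcoeff (E z) {} * inverse (gcoeff (E z) {}))
        \<in> O[at_infinity](\<lambda>_. 1 * 1)"
      using inv by (intro landau_o.big.mult)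
    moreover have "eventually (\<lambda>z. gcoeff (F z) S * gcoeff (E z) {} * inverse (gcoeff (E z) {}) =
        gcoeff (F z) S) at_infinity"
      using nz by eventually_elim simp
    ultimately show ?case
      by (simp add: landau_o.big.in_cong)
  qed
  moreover have "(\<lambda>z. gcoeff (F z) S) \<in> O[at_infinity](\<lambda>_. 1)" if "infinite S" for S
    using that by (simp add: gcoeff_infinite)
  ultimately show ?thesis
    unfolding bounded_at_infinity_def by blast
qed

text \<open>With \<open>w = 1 / z\<close>, the coefficients with \<open>\<theta>\<close> acquire a factor \<open>w\<close> from the change of charts, and
  those without \<open>\<theta>\<close> have a zero at \<open>w = 0\<close>.  In both cases multiplication by \<open>z\<close> leaves a finite limit.\<close>

lemma section_decay:
  assumes f: "f \<in> sections s (coord_patch C2)" and zero: "scale_theta 0 (f C2 0) = 0"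
  shows "((\<lambda>z. gcoeff (const_grassmann z * f C1 z) S) \<longlongrightarrow>
    (if 0 \<in> S then gcoeff (f C2 0) S else deriv (\<lambda>w. gcoeff (f C2 w) S) 0)) at_infinity"
proof -
  define h where "h = (\<lambda>w. gcoeff (f C2 w) S)"
  have hol: "h holomorphic_on UNIV"
    unfolding h_def using section_holomorphic[OF f, of C2 S] by (simp add: chart_vimage_patch)
  then have der: "(h has_field_derivative deriv h 0) (at 0)"
    by (simp add: holomorphic_derivI)
  have f1: "gcoeff (const_grassmann (inverse w) * f C1 (inverse w)) S =
      (if 0 \<in> S then h w else h w / w)" if "w \<noteq> 0" for w
    using section_transform[OF f, of C1 C2 "inverse w"] that by (simp add: h_def field_simps)
  have "((\<lambda>w. gcoeff (const_grassmann (inverse w) * f C1 (inverse w)) S) \<longlongrightarrow>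
      (if 0 \<in> S then h 0 else deriv h 0)) (at 0)"
  proof (cases "0 \<in> S")
    case True
    have "h \<midarrow>0\<rightarrow> h 0"
      using DERIV_isCont[OF der] by (simp add: isCont_def)
    then show ?thesis
      unfolding if_P[OF True] by (rule Lim_transform_eventually)
        (simp add: eventually_at_filter f1 True del: gcoeff_const_mult)
  next
    case False
    have "h 0 = 0"
      using arg_cong[OF zero, of "\<lambda>x. gcoeff x S"] False by (simp add: h_def)
    then have "((\<lambda>w. h w / w) \<longlongrightarrow> deriv h 0) (at 0)"
      using der by (simp add: has_field_derivative_iff)
    then show ?thesis
      unfolding if_not_P[OF False] by (rule Lim_transform_eventually)
        (simp add: eventually_at_filter f1 False del: gcoeff_const_mult)
  qed
  then show ?thesis
    unfolding lim_at_infinity_0 o_def h_def .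
qed

lemma section_decay_bounded:
  assumes "f \<in> sections s (coord_patch C2)" "scale_theta 0 (f C2 0) = 0"
  shows "bounded_at_infinity (\<lambda>z. const_grassmann z * f C1 z)"
  unfolding bounded_at_infinity_def
  using section_decay[OF assms] by (auto intro!: bigoI_tendsto simp del: gcoeff_const_mult)


section \<open>Automorphisms fixing zero and infinity\<close>

lemma
  assumes "morphism s \<Xi>"
  shows pullback_in: "open U \<Longrightarrow> f \<in> sections s U \<Longrightarrow> pullback \<Xi> U f \<in> sections s (on_points \<Xi> -` U)"
    and pullback_ext: "pullback \<Xi> \<in> (\<Pi>\<^sub>E U\<in>{U. open U}. sections s U \<rightarrow>\<^sub>E sections s (on_points \<Xi> -` U))"
    and pullback_res: "open U \<Longrightarrow> open V \<Longrightarrow> V \<subseteq> U \<Longrightarrow> f \<in> sections s U \<Longrightarrow>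
      pullback \<Xi> V (sec_res V f) = sec_res (on_points \<Xi> -` V) (pullback \<Xi> U f)"
    and pullback_add: "open U \<Longrightarrow> f \<in> sections s U \<Longrightarrow> g \<in> sections s U \<Longrightarrow>
      pullback \<Xi> U (sec_add f g) = sec_add (pullback \<Xi> U f) (pullback \<Xi> U g)"
    and pullback_mult: "open U \<Longrightarrow> f \<in> sections s U \<Longrightarrow> g \<in> sections s U \<Longrightarrow>
      pullback \<Xi> U (sec_mult f g) = sec_mult (pullback \<Xi> U f) (pullback \<Xi> U g)"
    and pullback_const: "open U \<Longrightarrow> a \<in> Lam s \<Longrightarrow>
      pullback \<Xi> U (sec_const U a) = sec_const (on_points \<Xi> -` U) a"
    and pullback_local: "open U \<Longrightarrow> f \<in> sections s U \<Longrightarrow> on_points \<Xi> p \<in> U \<Longrightarrow>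
      body_at f (on_points \<Xi> p) = 0 \<Longrightarrow> body_at (pullback \<Xi> U f) p = 0"
    and pullback_odd: "open U \<Longrightarrow> f \<in> sections s U \<Longrightarrow> odd_section f \<Longrightarrow> odd_section (pullback \<Xi> U f)"
proof -
  note m = assms[unfolded morphism_def, THEN conjunct2]
  show ext: "pullback \<Xi> \<in> (\<Pi>\<^sub>E U\<in>{U. open U}. sections s U \<rightarrow>\<^sub>E sections s (on_points \<Xi> -` U))"
    by (rule m[THEN conjunct1])
  show "open U \<Longrightarrow> f \<in> sections s U \<Longrightarrow> pullback \<Xi> U f \<in> sections s (on_points \<Xi> -` U)"
    using PiE_mem[OF PiE_mem[OF ext]] by simp
  note m = m[THEN conjunct2]
  show "open U \<Longrightarrow> open V \<Longrightarrow> V \<subseteq> U \<Longrightarrow> f \<in> sections s U \<Longrightarrow>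
      pullback \<Xi> V (sec_res V f) = sec_res (on_points \<Xi> -` V) (pullback \<Xi> U f)"
    using m[THEN conjunct1] by simp
  note m = m[THEN conjunct2, THEN conjunct2]
  show "open U \<Longrightarrow> f \<in> sections s U \<Longrightarrow> g \<in> sections s U \<Longrightarrow>
      pullback \<Xi> U (sec_add f g) = sec_add (pullback \<Xi> U f) (pullback \<Xi> U g)"
    "open U \<Longrightarrow> f \<in> sections s U \<Longrightarrow> g \<in> sections s U \<Longrightarrow>
      pullback \<Xi> U (sec_mult f g) = sec_mult (pullback \<Xi> U f) (pullback \<Xi> U g)"
    using m[THEN conjunct1] by simp_all
  note m = m[THEN conjunct2]
  show "open U \<Longrightarrow> a \<in> Lam s \<Longrightarrow> pullback \<Xi> U (sec_const U a) = sec_const (on_points \<Xi> -` U) a"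
    using m[THEN conjunct1] by simp
  show "open U \<Longrightarrow> f \<in> sections s U \<Longrightarrow> on_points \<Xi> p \<in> U \<Longrightarrow>
      body_at f (on_points \<Xi> p) = 0 \<Longrightarrow> body_at (pullback \<Xi> U f) p = 0"
    using m[THEN conjunct2] by simp
  show "open U \<Longrightarrow> f \<in> sections s U \<Longrightarrow> odd_section f \<Longrightarrow> odd_section (pullback \<Xi> U f)"
    using assms[unfolded morphism_def, THEN conjunct2, THEN conjunct2, THEN conjunct2, THEN conjunct1]
    by simp
qed

lemma automorphism_bij:
  assumes "automorphism s \<Xi>"
  shows "bij (on_points \<Xi>)"
proof -
  obtain \<Psi> where "comp_supermap s \<Xi> \<Psi> = id_supermap s" "comp_supermap s \<Psi> \<Xi> = id_supermap s"
    using assms by (auto simp: automorphism_def)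
  then have "on_points \<Xi> \<circ> on_points \<Psi> = id" "on_points \<Psi> \<circ> on_points \<Xi> = id"
    by (simp_all add: comp_supermap_def id_supermap_def)
  then show ?thesis
    by (rule o_bij[rotated])
qed

text \<open>The pull-back is local, and \<open>z\<^sub>i - w\<close> vanishes at the image point.\<close>

lemma body_pullback_coordinate:
  assumes m: "morphism s \<Xi>" and p: "on_points \<Xi> (chart j v) = chart i w"
  shows "gcoeff (pullback \<Xi> (coord_patch i) (z_section i) j v) {} = w"
proof -
  let ?U = "coord_patch i"
  \<comment> \<open>the section \<open>- w\<close>, to be added to \<open>z\<^sub>i\<close>\<close>
  let ?c = "sec_const ?U (const_grassmann (- w))"
  let ?p = "chart j v"
  have U: "open ?U" "chart i w \<in> ?U"
    by (auto simp: open_coord_patch chart_in_patch)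
  have c: "?c \<in> sections s ?U"
    using U(1) Lam_const by (rule sec_const_in)
  have add: "sec_add (z_section i) ?c \<in> sections s ?U"
    by (rule sec_add_in[OF z_section_in c])
  then have "body_at (sec_add (z_section i) ?c) (chart i w) = 0"
    using U(2) by (simp add: body_at_chart sec_add_def z_section_def sec_const_def)
  then have "body_at (pullback \<Xi> ?U (sec_add (z_section i) ?c)) ?p = 0"
    using pullback_local[OF m U(1) add, of ?p] p U(2) by simp
  moreover have "pullback \<Xi> ?U (sec_add (z_section i) ?c) =
      sec_add (pullback \<Xi> ?U (z_section i)) (sec_const (on_points \<Xi> -` ?U) (const_grassmann (- w)))"
    by (simp add: pullback_add[OF m U(1) z_section_in c] pullback_const[OF m U(1) Lam_const])
  moreover have "sec_add (pullback \<Xi> ?U (z_section i))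
      (sec_const (on_points \<Xi> -` ?U) (const_grassmann (- w))) \<in> sections s (on_points \<Xi> -` ?U)"
    using pullback_in[OF m U(1) add] calculation(2) by simp
  ultimately show ?thesis
    using p U(2) by (simp add: body_at_chart sec_add_def sec_const_def)
qed

lemma on_points_chart:
  assumes "morphism s \<Xi>" "on_points \<Xi> (chart j v) \<in> coord_patch i"
  shows "on_points \<Xi> (chart j v) = chart i (gcoeff (pullback \<Xi> (coord_patch i) (z_section i) j v) {})"
  using assms body_pullback_coordinate[OF assms(1)] unfolding coord_patch_def by auto

lemma fixed_vimage_patch:
  assumes "bij f" "f (Aff 0) = Aff 0" "f Infty = Infty"
  shows "f -` coord_patch i = coord_patch i"
proof -
  have "f p = Aff 0 \<longleftrightarrow> p = Aff 0" "f p = Infty \<longleftrightarrow> p = Infty" for p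
    using assms by (metis bij_pointE)+
  then show ?thesis
    by (cases i) (auto simp: coord_patch_eq)
qed

text \<open>A morphism that is bijective on points and fixes the points \<open>[0:1:0]\<close> and \<open>[1:0:0]\<close> over the base.
  The last four conditions say that the odd and the nilpotent parts of the coordinates are fixed as
  well.\<close>

locale fixes_zero_infinity =
  fixes s :: nat and \<Xi> :: supermap
  assumes morph: "morphism s \<Xi>" and bij: "bij (on_points \<Xi>)"
    and zero: "on_points \<Xi> (Aff 0) = Aff 0" and infty: "on_points \<Xi> Infty = Infty"
    and coordinates_zero: "scale_theta 0 (pullback \<Xi> (coord_patch C1) (z_section C1) C1 0) = 0"
      "scale_theta 0 (pullback \<Xi> (coord_patch C1) (theta_section C1) C1 0) = 0"
    and coordinates_infty: "scale_theta 0 (pullback \<Xi> (coord_patch C2) (z_section C2) C2 0) = 0"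
      "scale_theta 0 (pullback \<Xi> (coord_patch C2) (theta_section C2) C2 0) = 0"
begin

abbreviation "Z i \<equiv> pullback \<Xi> (coord_patch i) (z_section i)"
abbreviation "T i \<equiv> pullback \<Xi> (coord_patch i) (theta_section i)"

lemma vimage_patch: "on_points \<Xi> -` coord_patch i = coord_patch i"
  using bij zero infty by (rule fixed_vimage_patch)

lemma Z_in: "Z i \<in> sections s (coord_patch i)" and T_in: "T i \<in> sections s (coord_patch i)"
  using pullback_in[OF morph open_coord_patch z_section_in] vimage_patch
    pullback_in[OF morph open_coord_patch theta_section_in] by metis+

text \<open>The relations \<open>z\<^sub>1 z\<^sub>2 = 1\<close> and \<open>\<theta>\<^sub>2 z\<^sub>1 = \<theta>\<^sub>1\<close> are preserved by the pull-back.\<close>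

lemma overlap:
  assumes "z \<noteq> 0"
  shows "Z C1 C1 z * Z C2 C1 z = 1" "T C2 C1 z * Z C1 C1 z = T C1 C1 z"
proof -
  define W where "W = coord_patch C1 \<inter> coord_patch C2"
  have W: "open W" "W \<subseteq> coord_patch C1" "W \<subseteq> coord_patch C2"
    by (auto simp: W_def open_coord_patch)
  have W': "on_points \<Xi> -` W = W"
    unfolding W_def vimage_Int vimage_patch ..
  have zW: "chart C1 z \<in> W"
    using assms unfolding W_def by (auto simp: chart_in_patch simp del: chart.simps)
  have nz: "w \<noteq> 0" if "chart i w \<in> W" for i w
    using that unfolding W_def by (cases i) (auto simp: coord_patch_eq)
  have res: "pullback \<Xi> W (sec_res W (z_section i)) C1 z = Z i C1 z"
    "pullback \<Xi> W (sec_res W (theta_section i)) C1 z = T i C1 z" for i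
    using pullback_res[OF morph open_coord_patch W(1) _ z_section_in, of i] W(2,3) zW
      pullback_res[OF morph open_coord_patch W(1) _ theta_section_in, of i]
    by (cases i; simp add: W' sec_res_def del: chart.simps)+
  have in_W: "sec_res W (z_section i) \<in> sections s W" "sec_res W (theta_section i) \<in> sections s W" for i
    using W(2,3) by (cases i; auto intro: sec_res_in z_section_in theta_section_in)+
  have "sec_mult (sec_res W (z_section C1)) (sec_res W (z_section C2)) = sec_const W 1"
  proof (intro ext)
    fix i w
    show "sec_mult (sec_res W (z_section C1)) (sec_res W (z_section C2)) i w = sec_const W 1 i w"
      by (cases i) (auto simp: sec_mult_def sec_res_def z_section_def sec_const_def nz
          const_grassmann_arith(6)[symmetric] const_grassmann_arith(2) simp del: chart.simps)
  qed
  then have "sec_mult (pullback \<Xi> W (sec_res W (z_section C1))) (pullback \<Xi> W (sec_res W (z_section C2))) =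
      sec_const W 1"
    using pullback_mult[OF morph W(1) in_W(1,1)] pullback_const[OF morph W(1) Lam_one] W' by metis
  from fun_cong[OF fun_cong[OF this, of C1], of z] show "Z C1 C1 z * Z C2 C1 z = 1"
    using zW by (simp add: sec_mult_def res sec_const_def del: chart.simps)
  have swap: "theta * const_grassmann c = const_grassmann c * theta" for c
    by (rule grassmann_eqI) simp
  have "sec_mult (sec_res W (theta_section C2)) (sec_res W (z_section C1)) = sec_res W (theta_section C1)"
  proof (intro ext)
    fix i w
    have "const_grassmann (1 / w) * theta * const_grassmann w = theta" if "w \<noteq> 0"
      using that by (intro grassmann_eqI) simp
    then show "sec_mult (sec_res W (theta_section C2)) (sec_res W (z_section C1)) i w =
        sec_res W (theta_section C1) i w"
      by (cases i) (auto simp: sec_mult_def sec_res_def z_section_def theta_section_def nz swap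
          simp del: chart.simps)
  qed
  then have "sec_mult (pullback \<Xi> W (sec_res W (theta_section C2))) (pullback \<Xi> W (sec_res W (z_section C1))) =
      pullback \<Xi> W (sec_res W (theta_section C1))"
    using pullback_mult[OF morph W(1) in_W(2,1)] by metis
  from fun_cong[OF fun_cong[OF this, of C1], of z] show "T C2 C1 z * Z C1 C1 z = T C1 C1 z"
    by (simp add: sec_mult_def res)
qed

text \<open>This body is the underlying map in the coordinate \<open>z\<^sub>2\<close>, an injective holomorphic function.\<close>

lemma Z2_body_deriv: "deriv (\<lambda>w. gcoeff (Z C2 C2 w) {}) 0 \<noteq> 0"
proof -
  have "inj (\<lambda>w. gcoeff (Z C2 C2 w) {})"
  proof (rule injI)
    fix v w
    assume eq: "gcoeff (Z C2 C2 v) {} = gcoeff (Z C2 C2 w) {}"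
    have "on_points \<Xi> (chart C2 v) \<in> coord_patch C2" for v
      using vimage_patch[of C2] chart_in_patch[of C2 v C2] by blast
    then have "on_points \<Xi> (chart C2 v) = on_points \<Xi> (chart C2 w)"
      using on_points_chart[OF morph] eq by metis
    then show "v = w"
      using bij inj_chart by (metis bij_is_inj inj_eq)
  qed
  moreover have "(\<lambda>w. gcoeff (Z C2 C2 w) {}) holomorphic_on UNIV"
    using section_holomorphic[OF Z_in, of C2 C2 "{}"] by (simp add: chart_vimage_patch)
  ultimately show ?thesis
    by (intro holomorphic_injective_imp_regular[of _ UNIV]) auto
qed

text \<open>The product of this function with \<open>z H\<close>, where \<open>H\<close> is the pull-back of \<open>z\<^sub>2\<close>, is \<open>1\<close>.\<close>

lemma Z1_growth: "bounded_at_infinity (\<lambda>z. const_grassmann (1 / z) * Z C1 C1 z)"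
proof (rule bounded_at_infinity_quotient)
  let ?E = "\<lambda>z. const_grassmann z * Z C2 C1 z"
  show "bounded_at_infinity ?E"
    by (rule section_decay_bounded[OF Z_in coordinates_infty(1)])
  show "((\<lambda>z. gcoeff (?E z) {}) \<longlongrightarrow> deriv (\<lambda>w. gcoeff (Z C2 C2 w) {}) 0) at_infinity"
    using section_decay[OF Z_in coordinates_infty(1), of "{}"] by simp
  show "deriv (\<lambda>w. gcoeff (Z C2 C2 w) {}) 0 \<noteq> 0"
    by (rule Z2_body_deriv)
  have "const_grassmann (1 / z) * Z C1 C1 z * ?E z = 1" if "z \<noteq> 0" for z
  proof -
    have "const_grassmann (1 / z) * Z C1 C1 z * ?E z =
        const_grassmann (1 / z) * (Z C1 C1 z * const_grassmann z) * Z C2 C1 z"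
      by (simp add: mult.assoc)
    also have "Z C1 C1 z * const_grassmann z = const_grassmann z * Z C1 C1 z"
      by (rule grassmann_eqI) simp
    also have "const_grassmann (1 / z) * (const_grassmann z * Z C1 C1 z) = Z C1 C1 z"
      using that by (intro grassmann_eqI) simp
    finally show ?thesis
      using overlap(1)[OF that] by simp
  qed
  then show "bounded_at_infinity (\<lambda>z. const_grassmann (1 / z) * Z C1 C1 z * ?E z)"
    by (intro bounded_at_infinity_cong[OF bounded_at_infinity_const[of 1]]) simp
qed

text \<open>By \<open>\<theta>\<^sub>1 = \<theta>\<^sub>2 z\<^sub>1\<close>, the decay of the pull-back of \<open>\<theta>\<^sub>2\<close> compensates the growth of that of \<open>z\<^sub>1\<close>.\<close>

lemma T1_growth: "bounded_at_infinity (\<lambda>z. T C1 C1 z)"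
proof -
  have "bounded_at_infinity (\<lambda>z. const_grassmann z * T C2 C1 z)"
    by (rule section_decay_bounded[OF T_in coordinates_infty(2)])
  note b = bounded_at_infinity_mult[OF this Z1_growth]
  have "const_grassmann z * T C2 C1 z * (const_grassmann (1 / z) * Z C1 C1 z) = T C1 C1 z" if "z \<noteq> 0" for z
  proof -
    have "const_grassmann z * T C2 C1 z * (const_grassmann (1 / z) * Z C1 C1 z) =
        (const_grassmann z * T C2 C1 z * const_grassmann (1 / z)) * Z C1 C1 z"
      by (simp add: mult.assoc)
    also have "const_grassmann z * T C2 C1 z * const_grassmann (1 / z) = T C2 C1 z"
      using that by (intro grassmann_eqI) simp
    finally show ?thesis
      using overlap(2)[OF that] by simp
  qed
  then show ?thesis
    by (rule bounded_at_infinity_cong[OF b])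
qed

lemma T1_constant: "T C1 C1 z = T C1 C1 0"
proof (rule grassmann_eqI)
  fix S :: "nat set"
  have "(\<lambda>z. gcoeff (T C1 C1 z) S) holomorphic_on UNIV"
    using section_holomorphic[OF T_in, of C1 C1 S] by (simp add: chart_vimage_patch)
  moreover have "(\<lambda>z. gcoeff (T C1 C1 z) S / z ^ 0) \<in> O[at_infinity](\<lambda>_. 1)"
    using T1_growth by (simp add: bounded_at_infinity_def)
  ultimately show "gcoeff (T C1 C1 z) S = gcoeff (T C1 C1 0) S"
    by (subst entire_polynomial_growth[of _ 0]) auto
qed

lemma Z1_affine: "Z C1 C1 z = Z C1 C1 0 + const_grassmann z * d_z (Z C1 C1) 0"
proof (rule grassmann_eqI)
  fix S :: "nat set"
  have "(\<lambda>z. gcoeff (Z C1 C1 z) S) holomorphic_on UNIV"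
    using section_holomorphic[OF Z_in, of C1 C1 S] by (simp add: chart_vimage_patch)
  moreover have "(\<lambda>z. gcoeff (Z C1 C1 z) S / z ^ 1) \<in> O[at_infinity](\<lambda>_. 1)"
    using Z1_growth by (simp add: bounded_at_infinity_def)
  ultimately have "gcoeff (Z C1 C1 z) S = (\<Sum>k\<le>1. (deriv ^^ k) (\<lambda>z. gcoeff (Z C1 C1 z) S) 0 / fact k * z ^ k)"
    by (rule entire_polynomial_growth)
  then show "gcoeff (Z C1 C1 z) S = gcoeff (Z C1 C1 0 + const_grassmann z * d_z (Z C1 C1) 0) S"
    by simp
qed

end


section \<open>The superconformal condition\<close>

lemma deriv_affine: "deriv (\<lambda>w::complex. a + w * b) z = b"
  by (rule DERIV_imp_deriv) (auto intro!: derivative_eq_intros)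

lemma D_field_coordinates:
  "D_field C1 (\<lambda>w. a + const_grassmann w * b) z = d_theta (a + const_grassmann z * b) + theta * b"
proof -
  have "d_z (\<lambda>w. a + const_grassmann w * b) z = b"
    by (rule grassmann_eqI) (simp add: deriv_affine)
  then show ?thesis
    by simp
qed

lemma d_theta_theta_mult:
  assumes "a \<in> Lam s"
  shows "d_theta (theta * a) = a"
  by (rule grassmann_eqI) (simp add: Lam_coeff_zero[OF assms])

lemma D_vector_field_coordinates:
  "D_vector_field s (coord_patch C1) (z_section C1) = theta_section C1"
  "D_vector_field s (coord_patch C1) (theta_section C1) = sec_const (coord_patch C1) 1"
proof -
  let ?U = "coord_patch C1"
  note U = open_coord_patch[of C1]
  have "z_section C1 C1 = (\<lambda>w. 0 + const_grassmann w * 1)"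
    by (rule ext) (simp add: z_section_def)
  then have "D_field C1 (z_section C1 C1) z = d_theta (const_grassmann z) + theta" for z
    using D_field_coordinates[of 0 1 z] by simp
  then have 1: "D_field C1 (z_section C1 C1) z = theta" for z
    using d_theta_Lam_zero[OF Lam_const] by simp
  have "theta_section C1 C1 = (\<lambda>w. theta * 1 + const_grassmann w * 0)"
    by (rule ext) (simp add: theta_section_def)
  then have 2: "D_field C1 (theta_section C1 C1) z = 1" for z
    using D_field_coordinates[of "theta * 1" 0 z] d_theta_theta_mult[OF Lam_one] by simp
  have D: "D_vector_field s ?U f = local_section C1 ?U (D_field C1 (f C1))"
    "D_vector_field s ?U f \<in> sections s ?U" if "f \<in> sections s ?U" for f
    using that U D_field_section_in[OF U subset_refl that]
    by (auto simp: D_vector_field_def simp del: D_field.simps)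
  show "D_vector_field s ?U (z_section C1) = theta_section C1"
  proof (rule section_eq_on_patch[OF subset_refl D(2)[OF z_section_in] theta_section_in])
    fix z
    assume "chart C1 z \<in> ?U"
    then show "D_vector_field s ?U (z_section C1) C1 z = theta_section C1 C1 z"
      unfolding D(1)[OF z_section_in] by (simp only: local_section_apply 1) (simp add: theta_section_def)
  qed
  show "D_vector_field s ?U (theta_section C1) = sec_const ?U 1"
  proof (rule section_eq_on_patch[OF subset_refl D(2)[OF theta_section_in] sec_const_in[OF U Lam_one]])
    fix z
    assume "chart C1 z \<in> ?U"
    then show "D_vector_field s ?U (theta_section C1) C1 z = sec_const ?U 1 C1 z"
      unfolding D(1)[OF theta_section_in] by (simp only: local_section_apply 2 sec_const_def if_True)
  qed
qed

context fixes_zero_infinity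
begin

definition "scale_factor = d_theta (T C1 C1 0)"

lemma scale_factor_even: "scale_factor \<in> Lam_even s"
proof -
  have "odd_section (theta_section C1)"
    by (auto simp: odd_section_def theta_section_def odd_grassmann_def)
  then have "odd_grassmann (T C1 C1 0)"
    using pullback_odd[OF morph open_coord_patch theta_section_in] by (simp add: odd_section_def)
  then have "even_grassmann scale_factor"
    unfolding even_grassmann_def
  proof (intro allI impI)
    fix S
    assume S: "gcoeff scale_factor S \<noteq> 0"
    then have "0 \<notin> S" "odd (card (insert 0 S))"
      using \<open>odd_grassmann (T C1 C1 0)\<close> unfolding odd_grassmann_def scale_factor_def
      by (auto split: if_splits)
    then show "even (card S)"
      using S gcoeff_infinite[of S scale_factor] by (cases "finite S") auto
  qed
  then show ?thesis
    using d_theta_Lam[OF section_supported[OF T_in]] by (simp add: Lam_even_def scale_factor_def)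
qed

lemma T1_eq: "T C1 C1 z = theta * scale_factor"
  using T1_constant[of z] theta_decompose[of "T C1 C1 0"] coordinates_zero(2)
  by (simp add: scale_factor_def)

text \<open>The field related to \<open>D\<close> is \<open>h D\<close> for a superfunction \<open>h\<close>.  Applied to \<open>\<theta>\<^sub>1\<close> and \<open>z\<^sub>1\<close>, with \<open>D \<theta> = 1\<close> and
  \<open>D z = \<theta>\<close>, this shows that \<open>h\<close> is the inverse of the scale factor \<open>g\<close> and that \<open>h D F = \<theta> g\<close>, where
  \<open>F\<close> is the pull-back of \<open>z\<^sub>1\<close>.  So \<open>D F = \<theta> g\<^sup>2\<close>, and comparing coefficients in \<open>F = A + z B\<close> yields the
  claim.\<close>

lemma Z1_eq:
  assumes conf: "preserves_distribution s \<Xi>"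
  shows "Z C1 C1 z = const_grassmann z * (scale_factor * scale_factor)"
proof -
  let ?U = "coord_patch C1" and ?g = scale_factor
  define A B where "A = Z C1 C1 0" "B = d_z (Z C1 C1) 0"
  note U = open_coord_patch[of C1]
  have Z: "Z C1 C1 = (\<lambda>z. A + const_grassmann z * B)"
    by (rule ext) (simp only: A_B_def Z1_affine[symmetric])
  have T: "T C1 C1 = (\<lambda>z. theta * ?g + const_grassmann z * 0)"
    by (rule ext) (simp add: T1_eq)
  have g: "?g \<in> Lam s" "even_grassmann ?g"
    using scale_factor_even by (auto simp: Lam_even_def)
  have gg: "?g * ?g \<in> Lam s"
    using g(1) supported_mult by (auto simp: Lam_def)
  obtain X where X: "X \<in> distribution s ?U" and rel: "related_by s \<Xi> ?U X (D_vector_field s)"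
    using conf[unfolded preserves_distribution_def, THEN spec[of _ ?U], THEN mp, OF U, THEN conjunct2,
        THEN bspec, OF D_vector_field_in_distribution] vimage_patch[of C1] by auto
  obtain h where h: "\<And>V f z. open V \<Longrightarrow> V \<subseteq> ?U \<Longrightarrow> f \<in> sections s V \<Longrightarrow> chart C1 z \<in> V \<Longrightarrow>
      X V f C1 z = h C1 z * D_field C1 (f C1) z"
    using X[unfolded distribution_def mem_Collect_eq, THEN conjunct2, THEN spec[of _ C1]]
    by (elim bexE) (metis (no_types, lifting))
  have X_eq: "X ?U (pullback \<Xi> ?U f) = pullback \<Xi> ?U (D_vector_field s ?U f)"
    if "f \<in> sections s ?U" for f
    using rel[unfolded related_by_def, THEN spec[of _ ?U], THEN spec[of _ f]] that U
      vimage_patch[of C1] by simp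
  have zU: "chart C1 z \<in> ?U" for z
    by (simp add: chart_in_patch del: chart.simps)
  have hZ: "h C1 z * D_field C1 (Z C1 C1) z = theta * ?g" for z
    using h[OF U subset_refl Z_in zU, of z] X_eq[OF z_section_in] T1_eq
    by (simp add: D_vector_field_coordinates del: D_field.simps)
  have "h C1 z * D_field C1 (T C1 C1) z = 1" for z
    using h[OF U subset_refl T_in zU, of z] X_eq[OF theta_section_in] zU[of z]
      pullback_const[OF morph U Lam_one] vimage_patch[of C1]
    by (simp add: D_vector_field_coordinates sec_const_def del: D_field.simps chart.simps)
  then have hg: "h C1 z * ?g = 1" for z
    unfolding T D_field_coordinates by (simp add: d_theta_theta_mult[OF g(1)])
  have "D_field C1 (Z C1 C1) z = theta * (?g * ?g)" for z
  proof -
    have "D_field C1 (Z C1 C1) z = (?g * h C1 z) * D_field C1 (Z C1 C1) z"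
      using hg[of z] even_grassmann_central[OF g(2), of "h C1 z"] by (simp del: D_field.simps)
    also have "\<dots> = ?g * (theta * ?g)"
      using hZ[of z] by (simp add: mult.assoc del: D_field.simps)
    also have "\<dots> = theta * (?g * ?g)"
      using even_grassmann_central[OF g(2), of theta] by (metis mult.assoc)
    finally show ?thesis .
  qed
  then have D: "d_theta (A + const_grassmann z * B) + theta * B = theta * (?g * ?g)" for z
    unfolding Z D_field_coordinates .
  have A0: "gcoeff A S = 0" if "0 \<notin> S" for S
    using arg_cong[OF coordinates_zero(1), of "\<lambda>x. gcoeff x S"] that by (simp add: A_B_def)
  have AB: "gcoeff A (insert 0 S) = 0" "gcoeff B (insert 0 S) = 0" if "0 \<notin> S" for S
    using arg_cong[OF D[of 0], of "\<lambda>x. gcoeff x S"] arg_cong[OF D[of 1], of "\<lambda>x. gcoeff x S"] that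
    by simp_all
  \<comment> \<open>\<open>A\<close> vanishes modulo \<open>\<theta>\<close> by the fixed point \<open>0\<close>, its \<open>\<theta>\<close>-part
    by the condition on \<open>D F\<close>.\<close>
  have "gcoeff A S = 0" for S
    using A0[of S] AB(1)[of "S - {0}"] by (cases "0 \<in> S") (auto simp: insert_absorb)
  moreover have "gcoeff B S = gcoeff (?g * ?g) S" for S
  proof (cases "0 \<in> S")
    case True
    then show ?thesis
      using AB(2)[of "S - {0}"] Lam_coeff_zero[OF gg] by (simp add: insert_absorb)
  next
    case False
    then show ?thesis
      using arg_cong[OF D[of 0], of "\<lambda>x. gcoeff x (insert 0 S)"] by simp
  qed
  ultimately show ?thesis
    unfolding Z by (intro grassmann_eqI) simp
qed

end


section \<open>Morphisms are determined by the coordinates\<close>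

text \<open>Coefficientwise \<open>(F(z) - F(a)) / (z - a)\<close>, whose singularity at \<open>a\<close> is removable.\<close>

lift_definition divided_difference :: "(complex \<Rightarrow> grassmann) \<Rightarrow> complex \<Rightarrow> complex \<Rightarrow> grassmann"
  is "\<lambda>F a z S. if z = a then deriv (\<lambda>w. F w S) a else (F z S - F a S) / (z - a)"
  by simp

lemma section_divided_difference:
  assumes V: "open V" "V \<subseteq> coord_patch C1" and f: "f \<in> sections s V" and a: "chart C1 a \<in> V"
  obtains q where "q \<in> sections s V"
    and "\<And>z. chart C1 z \<in> V \<Longrightarrow> f C1 z = f C1 a + const_grassmann (z - a) * q C1 z"
proof
  let ?q = "divided_difference (f C1) a"
  note rep = divided_difference.rep_eq
  show "local_section C1 V ?q \<in> sections s V"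
  proof (rule local_section_in[OF V])
    fix z
    have "gcoeff (?q z) S = 0" if "\<not> S \<subseteq> {0..s}" for S
      using supported_coeff[OF section_supported[OF f] that] by (simp add: rep)
    then show "?q z \<in> supported {0..s}"
      unfolding supported_def by blast
  next
    fix S
    have "a \<in> interior (chart C1 -` V)"
      using a open_chart_vimage[OF V(1)] by (simp add: interior_open)
    then show "(\<lambda>z. gcoeff (?q z) S) holomorphic_on chart C1 -` V"
      unfolding rep by (rule pole_lemma[OF section_holomorphic[OF f]])
  qed
  fix z
  assume "chart C1 z \<in> V"
  then show "f C1 z = f C1 a + const_grassmann (z - a) * local_section C1 V ?q C1 z"
    by (intro grassmann_eqI) (simp add: local_section_def rep)
qed

lemma scale_section_in:
  "f \<in> sections s U \<Longrightarrow> (\<lambda>i z. scale_theta c (f i z)) \<in> sections s U"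
proof -
  assume f: "f \<in> sections s U"
  have "(\<lambda>z. gcoeff (scale_theta c (f i z)) S) holomorphic_on (chart i -` U)" for i S
    using section_holomorphic[OF f, of i S] by (cases "0 \<in> S") (auto intro!: holomorphic_intros)
  then show ?thesis
    using f by (auto simp: sections_def scale_theta_supported scale_theta_scale mult.commute
        simp del: scale_theta.rep_eq)
qed

text \<open>Near \<open>a\<close> write \<open>f = c\<^sub>0 + \<theta> c\<^sub>1 + (z - a) q\<close>.  The constants are fixed by the pull-back, and the last term
  becomes a multiple of \<open>z - a\<close>, whatever happens to \<open>q\<close>.  Hence the value at \<open>a\<close> is \<open>c\<^sub>0 + c \<theta> c\<^sub>1\<close>.\<close>

lemma pullback_determined:
  assumes m: "morphism s \<Xi>" and pts: "on_points \<Xi> = id"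
    and Z: "\<And>z. pullback \<Xi> (coord_patch C1) (z_section C1) C1 z = const_grassmann z"
    and T: "\<And>z. pullback \<Xi> (coord_patch C1) (theta_section C1) C1 z = const_grassmann c * theta"
    and U: "open U" and f: "f \<in> sections s U"
  shows "pullback \<Xi> U f = (\<lambda>i z. scale_theta c (f i z))"
proof (rule section_eqI[OF U])
  show "pullback \<Xi> U f \<in> sections s U"
    using pullback_in[OF m U f] pts by simp
  show "(\<lambda>i z. scale_theta c (f i z)) \<in> sections s U"
    by (rule scale_section_in[OF f])
next
  fix a
  assume "Aff a \<in> U"
  define V where "V = U \<inter> coord_patch C1"
  have V: "open V" "V \<subseteq> U" "V \<subseteq> coord_patch C1" and aV: "chart C1 a \<in> V"
    using \<open>Aff a \<in> U\<close> U open_coord_patch[of C1] by (auto simp: V_def chart_in_patch[of C1 a C1, simplified])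
  have vim: "on_points \<Xi> -` W = W" for W
    by (simp add: pts)
  define g where "g = sec_res V f"
  have g: "g \<in> sections s V"
    unfolding g_def by (rule sec_res_in[OF f V(2)])
  obtain q where q: "q \<in> sections s V"
    and gq: "\<And>z. chart C1 z \<in> V \<Longrightarrow> g C1 z = g C1 a + const_grassmann (z - a) * q C1 z"
    using section_divided_difference[OF V(1,3) g aV] by metis
  define c0 where "c0 = sec_const V (scale_theta 0 (g C1 a))"
  define c1 where "c1 = sec_const V (d_theta (g C1 a))"
  define b where "b = sec_const V (const_grassmann (- a))"
  define x where "x = sec_res V (z_section C1)"
  define t where "t = sec_res V (theta_section C1)"
  have Lam: "scale_theta 0 (g C1 a) \<in> Lam s" "d_theta (g C1 a) \<in> Lam s"
    by (auto intro!: scale_0_Lam d_theta_Lam section_supported[OF g])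
  have in_V: "c0 \<in> sections s V" "c1 \<in> sections s V" "b \<in> sections s V" "x \<in> sections s V" "t \<in> sections s V"
    unfolding c0_def c1_def b_def x_def t_def
    by (rule sec_const_in[OF V(1) Lam(1)] sec_const_in[OF V(1) Lam(2)] sec_const_in[OF V(1) Lam_const]
        sec_res_in[OF z_section_in V(3)] sec_res_in[OF theta_section_in V(3)])+
  have mid: "sec_add x b \<in> sections s V" "sec_mult t c1 \<in> sections s V"
    "sec_mult (sec_add x b) q \<in> sections s V" "sec_add c0 (sec_mult t c1) \<in> sections s V"
    by (intro sec_add_in sec_mult_in in_V q)+
  have "g = sec_add (sec_add c0 (sec_mult t c1)) (sec_mult (sec_add x b) q)"
  proof (rule section_eq_on_patch[OF V(3) g])
    fix z
    assume z: "chart C1 z \<in> V"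
    have "g C1 a = scale_theta 0 (g C1 a) + theta * d_theta (g C1 a)"
      by (rule theta_decompose)
    then show "g C1 z = sec_add (sec_add c0 (sec_mult t c1)) (sec_mult (sec_add x b) q) C1 z"
      using z gq[OF z]
      by (simp add: sec_add_def sec_mult_def c0_def c1_def x_def b_def t_def sec_const_def sec_res_def
          z_section_def theta_section_def const_grassmann_arith(4,5) del: chart.simps)
  qed (intro sec_add_in mid)
  then have "pullback \<Xi> V g = sec_add (sec_add (pullback \<Xi> V c0) (sec_mult (pullback \<Xi> V t) (pullback \<Xi> V c1)))
      (sec_mult (sec_add (pullback \<Xi> V x) (pullback \<Xi> V b)) (pullback \<Xi> V q))"
    using pullback_add[OF m V(1) mid(4,3)] pullback_add[OF m V(1) in_V(1) mid(2)]
      pullback_mult[OF m V(1) in_V(5,2)] pullback_mult[OF m V(1) mid(1) q]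
      pullback_add[OF m V(1) in_V(4,3)] by simp
  moreover have "pullback \<Xi> V c0 = c0" "pullback \<Xi> V c1 = c1" "pullback \<Xi> V b = b"
    unfolding c0_def c1_def b_def using pullback_const[OF m V(1)] Lam Lam_const vim by simp_all
  moreover have "pullback \<Xi> V x C1 a = const_grassmann a" "pullback \<Xi> V t C1 a = const_grassmann c * theta"
    unfolding x_def t_def
    using pullback_res[OF m open_coord_patch V(1,3)] z_section_in theta_section_in aV
    by (simp_all add: vim sec_res_def Z T del: chart.simps)
  ultimately have "pullback \<Xi> V g C1 a =
      scale_theta 0 (g C1 a) + const_grassmann c * theta * d_theta (g C1 a)"
    using aV by (simp add: sec_add_def sec_mult_def c0_def c1_def b_def sec_const_def
        const_grassmann_arith(5) del: chart.simps)
  also have "\<dots> = scale_theta c (g C1 a)"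
    by (rule grassmann_eqI) (simp add: mult.assoc insert_absorb)
  finally show "pullback \<Xi> U f C1 a = scale_theta c (f C1 a)"
    using pullback_res[OF m U V(1,2) f] aV by (simp add: g_def vim sec_res_def del: chart.simps)
qed

text \<open>The pull-back of \<open>z\<^sub>1\<close> also determines the underlying map: its body is that map in the coordinate
  \<open>z\<^sub>1\<close>.\<close>

lemma supermap_determined:
  assumes m: "morphism s \<Xi>" and pts: "on_points \<Xi> Infty = Infty"
    "on_points \<Xi> -` coord_patch C1 = coord_patch C1"
    and Z: "\<And>z. pullback \<Xi> (coord_patch C1) (z_section C1) C1 z = const_grassmann z"
    and T: "\<And>z. pullback \<Xi> (coord_patch C1) (theta_section C1) C1 z = const_grassmann c * theta"
  shows "\<Xi> = \<lparr>on_points = id, pullback = (\<lambda>U\<in>{U. open U}. \<lambda>f\<in>sections s U. \<lambda>i z. scale_theta c (f i z))\<rparr>"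
proof -
  have "on_points \<Xi> p = p" for p
  proof (cases p)
    case (Aff z)
    have "on_points \<Xi> (chart C1 z) \<in> coord_patch C1"
      using pts(2) chart_in_patch[of C1 z C1] by blast
    then show ?thesis
      using on_points_chart[OF m, of C1 z C1] Aff by (simp add: Z)
  qed (simp add: pts)
  then have id: "on_points \<Xi> = id"
    by (simp add: fun_eq_iff)
  have ext: "pullback \<Xi> \<in> (\<Pi>\<^sub>E U\<in>{U. open U}. sections s U \<rightarrow>\<^sub>E sections s U)"
    using pullback_ext[OF m] by (simp add: id)
  have "pullback \<Xi> U f = (\<lambda>U\<in>{U. open U}. \<lambda>f\<in>sections s U. \<lambda>i z. scale_theta c (f i z)) U f" for U f
  proof (cases "open U")
    case True
    then have "pullback \<Xi> U \<in> sections s U \<rightarrow>\<^sub>E sections s U"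
      using PiE_mem[OF ext] by simp
    then show ?thesis
      using True pullback_determined[OF m id Z T True, of f] PiE_arb[of "pullback \<Xi> U" "sections s U" _ f]
      by (cases "f \<in> sections s U") simp_all
  next
    case False
    then show ?thesis
      using PiE_arb[OF ext, of U] by simp
  qed
  then have "pullback \<Xi> = (\<lambda>U\<in>{U. open U}. \<lambda>f\<in>sections s U. \<lambda>i z. scale_theta c (f i z))"
    by blast
  with id show ?thesis
    by (intro supermap.equality) auto
qed


section \<open>Three points determine a superconformal automorphism up to reflection\<close>

lemma has_coordinates_image:
  assumes "has_coordinates s (image_point \<Xi> (eval_point j v e)) (Z1, Z2, \<Theta>)"
  shows "Z2 = 1 \<Longrightarrow> on_points \<Xi> (chart j v) \<in> coord_patch C1 \<and>
      subst_theta e (pullback \<Xi> (coord_patch C1) (z_section C1) j v) = Z1 \<and>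
      subst_theta e (pullback \<Xi> (coord_patch C1) (theta_section C1) j v) = \<Theta>"
    and "Z1 = 1 \<Longrightarrow> on_points \<Xi> (chart j v) \<in> coord_patch C2 \<and>
      subst_theta e (pullback \<Xi> (coord_patch C2) (z_section C2) j v) = Z2 \<and>
      subst_theta e (pullback \<Xi> (coord_patch C2) (theta_section C2) j v) = \<Theta>"
  using assms by (auto simp: has_coordinates_def image_point_def eval_point_def Lam_invertible_one)

theorem proposition3p1p14:
  fixes s :: nat and \<Xi> :: supermap and \<epsilon> \<epsilon>' :: grassmann
  assumes "superconformal_automorphism s \<Xi>"
    and "\<epsilon> \<in> Lam_odd s" and "\<epsilon>' \<in> Lam_odd s"
    and "maps_point s \<Xi> (0, 1, 0) (0, 1, 0)"
    and "maps_point s \<Xi> (1, 1, \<epsilon>) (1, 1, \<epsilon>')"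
    and "maps_point s \<Xi> (1, 0, 0) (1, 0, 0)"
  shows "(\<epsilon> = \<epsilon>' \<or> \<epsilon> = - \<epsilon>') \<and>
    (\<epsilon> = 0 \<and> \<epsilon>' = 0 \<longrightarrow> \<Xi> = id_supermap s \<or> \<Xi> = reflection s) \<and>
    (\<epsilon> \<noteq> 0 \<and> \<epsilon> = \<epsilon>' \<longrightarrow> \<Xi> = id_supermap s) \<and>
    (\<epsilon> \<noteq> 0 \<and> \<epsilon> = - \<epsilon>' \<longrightarrow> \<Xi> = reflection s)"
proof -
  have m: "morphism s \<Xi>" and bij: "bij (on_points \<Xi>)" and conf: "preserves_distribution s \<Xi>"
    using assms(1) automorphism_bij by (auto simp: superconformal_automorphism_def automorphism_def)
  have "has_coordinates s (image_point \<Xi> (eval_point C1 0 0)) (0, 1, 0)"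
    using assms(4) has_coordinates_eval_point(1) by (simp add: maps_point_def)
  note at_zero = has_coordinates_image(1)[OF this refl, unfolded subst_theta_0]
  have "has_coordinates s (image_point \<Xi> (eval_point C2 0 0)) (1, 0, 0)"
    using assms(6) has_coordinates_eval_point(2) by (simp add: maps_point_def)
  note at_infty = has_coordinates_image(2)[OF this refl, unfolded subst_theta_0]
  have "has_coordinates s (image_point \<Xi> (eval_point C1 1 \<epsilon>)) (1, 1, \<epsilon>')"
    using assms(5) has_coordinates_eval_point(3)[OF assms(2)] by (simp add: maps_point_def)
  note at_one = has_coordinates_image(1)[OF this refl]
  have body: "gcoeff x {} = 0" if "scale_theta 0 x = 0" for x
    using arg_cong[OF that, of "\<lambda>x. gcoeff x {}"] by simp
  interpret fixes_zero_infinity s \<Xi>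
  proof
    show "on_points \<Xi> (Aff 0) = Aff 0"
      using on_points_chart[OF m, of C1 0 C1] at_zero body by simp
    show "on_points \<Xi> Infty = Infty"
      using on_points_chart[OF m, of C2 0 C2] at_infty body by simp
  qed (use m bij at_zero at_infty in auto)
  let ?g = scale_factor
  have g: "?g \<in> Lam s" "even_grassmann ?g" "odd_grassmann \<epsilon>"
    using scale_factor_even assms(2) by (auto simp: Lam_even_def Lam_odd_def)
  have "?g * ?g = 1"
    using at_one g by (simp add: Z1_eq[OF conf] subst_theta_mult subst_theta_Lam const_grassmann_arith)
  then have pm: "?g = 1 \<or> ?g = - 1"
    by (rule square_root_one)
  have \<epsilon>': "\<epsilon>' = \<epsilon> * ?g"
    using at_one g by (simp add: T1_eq subst_theta_mult subst_theta_Lam subst_theta_theta)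
  have Z: "Z C1 C1 z = const_grassmann z" for z
    using pm by (auto simp: Z1_eq[OF conf])
  have determined: "\<Xi> = \<lparr>on_points = id, pullback = (\<lambda>U\<in>{U. open U}. \<lambda>f\<in>sections s U. \<lambda>i z. scale_theta c (f i z))\<rparr>"
    if "?g = const_grassmann c" for c
  proof (rule supermap_determined[OF m infty vimage_patch Z])
    show "T C1 C1 z = const_grassmann c * theta" for z
      unfolding T1_eq that by (rule grassmann_eqI) simp
  qed
  have id: "\<Xi> = id_supermap s" if "?g = 1"
    using determined[of 1] that by (simp add: id_supermap_def const_grassmann_arith)
  have reflection: "\<Xi> = reflection s" if "?g = - 1"
    using determined[of "-1"] that by (simp add: reflection_def const_grassmann_arith)
  have two: "x = 0" if "x = - x" for x :: grassmann
  proof (rule grassmann_eqI)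
    show "gcoeff x S = gcoeff 0 S" for S
      using arg_cong[OF that, of "\<lambda>x. gcoeff x S"] by simp
  qed
  show ?thesis
    using pm
  proof
    assume "?g = 1"
    then show ?thesis
      using id \<epsilon>' two[of \<epsilon>] by auto
  next
    assume "?g = - 1"
    then show ?thesis
      using reflection \<epsilon>' two[of \<epsilon>] by auto
  qed
qed

end
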